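(* Let $m,p,n$ be positive integers with $p\mid m$ and let $w\in G(m,p,n)$. Then $[\mathrm{id},w]_{\ell_R}=[\mathrm{id},w]_{\mathrm{cdf}}$ if and only if both of the following hold: (1) the multiset of cycle weights of $w$ that are not $\equiv 0 \pmod p$ can be partitioned into pairs whose two weights sum to $0$ in $\mathbb{Z}/m\mathbb{Z}$ (equivalently, $\ell_R(w)=\operatorname{codim}\operatorname{fix}(w)$); and (2) for every set $S$ of cycles of $w$ whose weights sum to $0 \pmod p$, the set $S$ can be partitioned into singletons $\{C\}$ with $C$ of weight $\equiv 0\pmod p$ and pairs $\{C,C'\}$ of cycles whose weights sum to $0$ in $\mathbb{Z}/m\mathbb{Z}$.
   Context: Let $m,p,n$ be positive integers with $p\mid m$ and $\zeta=e^{2\pi i/m}$. The group $G(m,1,n)$ consists of pairs $w=[u;a]$ with $u\in\mathfrak S_n$ (the underlying permutation) and $a=(a_1,\dots,a_n)\in(\mathbb Z/m\mathbb Z)^n$ (the weights); $[u;a]$ is identified with the $n\times n$ monomial matrix having entry $\zeta^{a_i}$ in position $(u(i),i)$ and zeros elsewhere, the group law is matrix multiplication, and the group acts on $\mathbb C^n$. A cycle of $w$ is a cycle of $u$ (fixed points count as cycles of size $1$); $c(w)$ is the number of cycles of $w$ and $c_0(w)$ the number of cycles of weight $0$, where the weight of a set $I\subseteq[n]$ (e.g. the underlying set of a cycle) is $\sum_{i\in I}a_i\in\mathbb Z/m\mathbb Z$, and $\mathrm{wt}(w)=\sum_{i=1}^n a_i$. Since $p\mid m$, it makes sense to say an element of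 $\mathbb Z/m\mathbb Z$ is $\equiv 0\pmod p$. $G(m,p,n)=\{w\in G(m,1,n):\mathrm{wt}(w)\equiv 0\pmod p\}$. A reflection is an element $g$ whose fixed space $\operatorname{fix}(g)=\ker(g-1)\subseteq\mathbb C^n$ has codimension $1$; $R$ is the set of reflections of $G(m,p,n)$ (they generate the group). $\ell_R(g)$ is the minimum number of reflections whose product is $g$, and $\operatorname{codim}\operatorname{fix}(g)=n-\dim\operatorname{fix}(g)$. For $f\in\{\ell_R,\operatorname{codim}\operatorname{fix}\}$ define $x\le_f y$ iff $f(x)+f(x^{-1}y)=f(y)$ (a partial order), and $[\mathrm{id},w]_f=\{u: u\le_f w\}$; the subscript $\mathrm{cdf}$ means $f=\operatorname{codim}\operatorname{fix}$. *)

theory Defs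
  imports Complex_Main "Jordan_Normal_Form.Matrix_Kernel" "HOL-Library.Disjoint_Sets"
begin

text \<open>Elements of G(m,1,n): an underlying permutation u of {0..<n} (identity outside)
  and integer weights a (read modulo m). Indices are 0-based.\<close>

definition zeta :: "nat \<Rightarrow> complex" where
  "zeta m = cis (2 * pi / real m)"

definition monomial_mat :: "nat \<Rightarrow> nat \<Rightarrow> (nat \<Rightarrow> nat) \<Rightarrow> (nat \<Rightarrow> int) \<Rightarrow> complex mat" where
  "monomial_mat m n u a = mat n n (\<lambda>(r, c). if r = u c then zeta m powi a c else 0)"

definition wt :: "(nat \<Rightarrow> int) \<Rightarrow> nat set \<Rightarrow> int" where
  "wt a I = (\<Sum>i\<in>I. a i)"

definition Gmpn :: "nat \<Rightarrow> nat \<Rightarrow> nat \<Rightarrow> complex mat set" where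
  "Gmpn m p n = {monomial_mat m n u a | u a. u permutes {..<n} \<and> int p dvd wt a {..<n}}"

definition codimfix :: "nat \<Rightarrow> complex mat \<Rightarrow> nat" where
  "codimfix n g = n - kernel_dim (g - 1\<^sub>m n)"

definition reflections :: "nat \<Rightarrow> nat \<Rightarrow> nat \<Rightarrow> complex mat set" where
  "reflections m p n = {g \<in> Gmpn m p n. codimfix n g = 1}"

definition lenR :: "nat \<Rightarrow> nat \<Rightarrow> nat \<Rightarrow> complex mat \<Rightarrow> nat" where
  "lenR m p n g = (LEAST k. \<exists>rs. length rs = k \<and> set rs \<subseteq> reflections m p n
                      \<and> foldr (*) rs (1\<^sub>m n) = g)"

definition ginv :: "nat \<Rightarrow> nat \<Rightarrow> nat \<Rightarrow> complex mat \<Rightarrow> complex mat" where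
  "ginv m p n x = (THE z. z \<in> Gmpn m p n \<and> z * x = 1\<^sub>m n)"

definition le_f :: "nat \<Rightarrow> nat \<Rightarrow> nat \<Rightarrow> (complex mat \<Rightarrow> nat) \<Rightarrow> complex mat \<Rightarrow> complex mat \<Rightarrow> bool" where
  "le_f m p n f x y \<longleftrightarrow> f x + f (ginv m p n x * y) = f y"

definition interval_f :: "nat \<Rightarrow> nat \<Rightarrow> nat \<Rightarrow> (complex mat \<Rightarrow> nat) \<Rightarrow> complex mat \<Rightarrow> complex mat set" where
  "interval_f m p n f w = {x \<in> Gmpn m p n. le_f m p n f x w}"

definition cycles_of :: "nat \<Rightarrow> (nat \<Rightarrow> nat) \<Rightarrow> nat set set" where
  "cycles_of n u = {{(u ^^ k) i | k. True} | i. i < n}"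

definition cond1 :: "nat \<Rightarrow> nat \<Rightarrow> nat \<Rightarrow> (nat \<Rightarrow> nat) \<Rightarrow> (nat \<Rightarrow> int) \<Rightarrow> bool" where
  "cond1 m p n u a \<longleftrightarrow>
     (\<exists>P. partition_on {C \<in> cycles_of n u. \<not> int p dvd wt a C} P \<and>
          (\<forall>B\<in>P. \<exists>C C'. B = {C, C'} \<and> C \<noteq> C' \<and> int m dvd wt a C + wt a C'))"

definition cond2 :: "nat \<Rightarrow> nat \<Rightarrow> nat \<Rightarrow> (nat \<Rightarrow> nat) \<Rightarrow> (nat \<Rightarrow> int) \<Rightarrow> bool" where
  "cond2 m p n u a \<longleftrightarrow>
     (\<forall>S \<subseteq> cycles_of n u. int p dvd (\<Sum>C\<in>S. wt a C) \<longrightarrow>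
        (\<exists>P. partition_on S P \<and>
             (\<forall>B\<in>P. (\<exists>C. B = {C} \<and> int p dvd wt a C) \<or>
                     (\<exists>C C'. B = {C, C'} \<and> C \<noteq> C' \<and> int m dvd wt a C + wt a C'))))"

end

theory Submission
  imports Defs "HOL-Library.Multiset" "HOL-Combinatorics.Cycles"
begin

text \<open>
  Everything is read off the multiset of cycle weights modulo \<open>m\<close>. The codimension of the fixed
  space is \<open>n\<close> minus the number of weights that are \<open>0\<close>, and multiplication by a reflection merges
  two weights, splits one, or shifts one by a multiple of \<open>p\<close>. Following Shi, this shows that
  the reflection length is \<open>n\<close> plus the least cost of a partition of the weights into blocks with
  sum \<open>0\<close> modulo \<open>p\<close>, where a block \<open>B\<close> costs \<open>|B| - 1\<close>, less \<open>1\<close> if its sum is \<open>0\<close>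
  modulo \<open>m\<close>. The cost is at least minus the number of zero weights, with equality exactly when
  the blocks can be taken to be singletons and pairs with sum \<open>0\<close>.

  If no such pairing of all weights exists, an optimal partition has a block in which merging
  two cycles lowers the length but not the codimension, so the intervals differ. Otherwise length
  and codimension agree at \<open>w\<close>, and the intervals are equal iff the two functions agree on the
  whole codimension interval. Along that interval (computed in \<open>G(m,1,n)\<close>) the nonzero weights only
  shrink to sub-multisets, and every sub-multiset with sum \<open>0\<close> modulo \<open>p\<close> is realised by
  killing the remaining weights with diagonal reflections.
\<close>

section \<open>Null partitions of weight multisets\<close>

text \<open>The cost counts reflections. Merging the cycles of a block \<open>B\<close> takes
  \<open>|B| - 1\<close> reflections and leaves one cycle, on \<open>s\<close> points say, whose
  weight is divisible by \<open>p\<close>. Reducing it to the identity takes \<open>s - 1\<close>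
  more if that weight is 0 modulo \<open>m\<close>, and \<open>s\<close> otherwise. Summed over the
  blocks this is \<open>n\<close> plus the cost. Two obstacles shape the rest. An element of
  codimension \<open>k\<close> in G(m,p,n) need not be a product of \<open>k\<close> of its
  reflections, so chains along the codimension order may leave the group. In G(m,1,n) codimension is
  a word length, so the chains are built there; an element built this way lies in G(m,p,n) as soon
  as its weights sum to 0 modulo \<open>p\<close>. Moreover, equality of the intervals concerns both
  factors of \<open>w = x * y\<close>, while the argument on weights treats a left factor; a
  conjugation brings \<open>y\<close> to the left.\<close>

definition block_cost :: "int \<Rightarrow> int multiset \<Rightarrow> int" where
  "block_cost m B = int (size B) - 1 - of_bool (m dvd \<Sum>\<^sub># B)"

definition cost :: "int \<Rightarrow> int multiset multiset \<Rightarrow> int" where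
  "cost m D = (\<Sum>B\<in>#D. block_cost m B)"

definition null_partition :: "int \<Rightarrow> int multiset \<Rightarrow> int multiset multiset \<Rightarrow> bool" where
  "null_partition p M D \<longleftrightarrow> \<Sum>\<^sub># D = M \<and> (\<forall>B\<in>#D. B \<noteq> {#} \<and> p dvd \<Sum>\<^sub># B)"

definition zeros :: "int \<Rightarrow> int multiset \<Rightarrow> nat" where
  "zeros m M = size (filter_mset (\<lambda>x. m dvd x) M)"

text \<open>The blocks allowed in \<open>cond2\<close>, with cycles replaced by their weights. A
  pair may consist of two null weights, which is why \<open>cost_if_paired\<close> has to break such
  pairs up.\<close>

inductive paired :: "int \<Rightarrow> int \<Rightarrow> int multiset \<Rightarrow> bool" for m p where
  empty: "paired m p {#}"
| single: "paired m p M \<Longrightarrow> p dvd x \<Longrightarrow> paired m p (M + {#x#})"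
| pair: "paired m p M \<Longrightarrow> m dvd x + y \<Longrightarrow> paired m p (M + {#x, y#})"

lemma cost_empty [simp]: "cost m {#} = 0"
  by (simp add: cost_def)

lemma cost_add_mset [simp]: "cost m (add_mset B D) = block_cost m B + cost m D"
  by (simp add: cost_def)

lemma zeros_empty [simp]: "zeros m {#} = 0"
  by (simp add: zeros_def)

lemma zeros_add [simp]: "zeros m (M + M') = zeros m M + zeros m M'"
  by (simp add: zeros_def)

lemma zeros_add_mset [simp]: "zeros m (add_mset x M) = of_bool (m dvd x) + zeros m M"
  by (simp add: zeros_def)

lemma null_partition_empty [simp]: "null_partition p M {#} \<longleftrightarrow> M = {#}"
  by (auto simp: null_partition_def)

lemma null_partition_add_mset:
  "null_partition p M (add_mset B D) \<longleftrightarrow>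
     B \<noteq> {#} \<and> p dvd \<Sum>\<^sub># B \<and> B \<subseteq># M \<and> null_partition p (M - B) D"
  by (auto simp: null_partition_def)

lemma paired_add: "paired m p M \<Longrightarrow> paired m p N \<Longrightarrow> paired m p (M + N)"
proof (induction rule: paired.induct)
  case (single M x)
  then show ?case using paired.single[of m p "M + N" x] by simp
next
  case (pair M x y)
  then show ?case using paired.pair[of m p "M + N" x y] by simp
qed simp

lemma paired_sum_mset: "(\<And>B. B \<in># D \<Longrightarrow> paired m p B) \<Longrightarrow> paired m p (\<Sum>\<^sub># D)"
  by (induction D) (auto intro: paired_add paired.empty)

lemma sum_mset_dvd: "(\<And>x. x \<in># M \<Longrightarrow> p dvd x) \<Longrightarrow> (p::int) dvd \<Sum>\<^sub># M"
  by (induction M) auto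

lemma size_ge_2E:
  assumes "size B \<ge> 2"
  obtains x y C where "B = C + {#x, y#}"
proof -
  have "B \<noteq> {#}" using assms by auto
  then obtain x B1 where B1: "B = add_mset x B1" by (meson multiset_cases)
  then have "B1 \<noteq> {#}" using assms by auto
  then obtain y C where "B1 = add_mset y C" by (meson multiset_cases)
  then show thesis using that[of C x y] B1 by (simp add: add_mset_commute)
qed

text \<open>A singleton costs exactly minus the number of its null weights. From size 2 on the cost
  is nonnegative, since a null sum saves only 1.\<close>

lemma block_cost_ge:
  assumes "B \<noteq> {#}"
  shows "- int (zeros m B) \<le> block_cost m B"
proof (cases "size B = 1")
  case True
  then obtain x where "B = {#x#}" using size_1_singleton_mset by blast
  then show ?thesis by (simp add: block_cost_def)
next
  case False
  then have "size B \<ge> 2" using assms by (cases "size B") auto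
  then show ?thesis by (simp add: block_cost_def)
qed

text \<open>For size at least 2 the cost is at least 0 and the right-hand side at most 0. Equality
  makes the cost 0, which leaves only size 2 with null sum.\<close>

lemma paired_if_block_cost:
  assumes "B \<noteq> {#}" "p dvd \<Sum>\<^sub># B" "block_cost m B = - int (zeros m B)"
  shows "paired m p B"
proof (cases "size B = 1")
  case True
  then obtain x where "B = {#x#}" using size_1_singleton_mset by blast
  then show ?thesis using assms paired.single[OF paired.empty, of p x m] by simp
next
  case False
  then have "size B \<ge> 2" using assms(1) by (cases "size B") auto
  with assms(3) have "size B = 2" "m dvd \<Sum>\<^sub># B"
    by (auto simp: block_cost_def of_bool_def split: if_splits)
  moreover obtain x y C where "B = C + {#x, y#}" using size_ge_2E[OF \<open>size B \<ge> 2\<close>] .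
  ultimately show ?thesis
    using paired.pair[OF paired.empty, of m x y p] by simp
qed

lemma cost_ge:
  "null_partition p M D \<Longrightarrow> - int (zeros m M) \<le> cost m D"
proof (induction D arbitrary: M)
  case (add B D)
  then have *: "B \<noteq> {#}" "B \<subseteq># M" "null_partition p (M - B) D"
    by (auto simp: null_partition_add_mset)
  have "zeros m M = zeros m B + zeros m (M - B)"
    using *(2) by (metis zeros_add subset_mset.add_diff_inverse)
  then show ?case using add.IH[OF *(3)] block_cost_ge[OF *(1), of m] by simp
qed simp

text \<open>The bound \<open>cost_ge\<close> is a sum of bounds on single blocks, so equality in
  total is equality in every block.\<close>

lemma paired_if_cost:
  "null_partition p M D \<Longrightarrow> cost m D = - int (zeros m M) \<Longrightarrow> paired m p M"
proof (induction D arbitrary: M)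
  case (add B D)
  then have *: "B \<noteq> {#}" "p dvd \<Sum>\<^sub># B" "B \<subseteq># M" "null_partition p (M - B) D"
    by (auto simp: null_partition_add_mset)
  have M: "M = B + (M - B)" using *(3) by simp
  have "zeros m M = zeros m B + zeros m (M - B)"
    using M by (metis zeros_add)
  then have "block_cost m B = - int (zeros m B)" "cost m D = - int (zeros m (M - B))"
    using add.prems(2) block_cost_ge[OF *(1), of m] cost_ge[OF *(4), of m] by auto
  then show ?case
    using paired_if_block_cost[OF *(1,2)] add.IH[OF *(4)] M paired_add by metis
qed (auto intro: paired.empty)

lemma cost_if_paired:
  assumes "p dvd m" "paired m p M"
  shows "\<exists>D. null_partition p M D \<and> cost m D = - int (zeros m M)"
  using assms(2)
proof induction
  case empty
  then show ?case by (intro exI[of _ "{#}"]) auto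
next
  case (single M x)
  then obtain D where D: "null_partition p M D" "cost m D = - int (zeros m M)" by auto
  then show ?case using single
    by (intro exI[of _ "add_mset {#x#} D"]) (auto simp: null_partition_def block_cost_def)
next
  case (pair M x y)
  then obtain D where D: "null_partition p M D" "cost m D = - int (zeros m M)" by auto
  have p: "p dvd x + y" using assms(1) pair by (meson dvd_trans)
  show ?case
  proof (cases "m dvd x")
    \<comment> \<open>Two null weights in one block cost 0, but \<open>zeros\<close> counts both; as
      singletons they cost -1 each.\<close>
    case True
    then have y: "m dvd y" using pair by (simp add: dvd_add_right_iff)
    then show ?thesis using D True assms(1) dvd_trans[OF assms(1)]
      by (intro exI[of _ "add_mset {#x#} (add_mset {#y#} D)"])
        (auto simp: null_partition_def block_cost_def)
  next
    case False
    then have y: "\<not> m dvd y" using pair(2) by (metis dvd_add_left_iff)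
    then show ?thesis using D False pair p
      by (intro exI[of _ "add_mset {#x, y#} D"])
        (auto simp: null_partition_def block_cost_def)
  qed
qed

text \<open>In a pair with null sum both weights are null or neither is, so removing the null
  weights never tears a pair apart.\<close>

lemma paired_cancel_null:
  assumes "paired m p M"
  shows "paired m p (filter_mset (\<lambda>x. \<not> m dvd x) M)"
  using assms
proof induction
  case (single M x)
  then show ?case by (auto intro: paired.single[of m p _ x, simplified])
next
  case (pair M x y)
  have "m dvd x \<longleftrightarrow> m dvd y"
    using pair(2) by (metis dvd_add_left_iff dvd_add_right_iff)
  then show ?case using pair by (auto intro: paired.pair[of m p _ x y, simplified])
qed (auto intro: paired.empty)

text \<open>Right multiplication by a reflection changes the multiset of cycle weights in one of three
  ways: two weights are replaced by their sum modulo \<open>m\<close>, the converse happens, or one weight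
  moves by a multiple of \<open>p\<close>.\<close>
definition merges :: "int \<Rightarrow> int multiset \<Rightarrow> int multiset \<Rightarrow> bool" where
  "merges m M M' \<longleftrightarrow> (\<exists>M0 x y z. M = M0 + {#x, y#} \<and> M' = M0 + {#z#} \<and> m dvd z - (x + y))"

definition shifts :: "int \<Rightarrow> int multiset \<Rightarrow> int multiset \<Rightarrow> bool" where
  "shifts p M M' \<longleftrightarrow> (\<exists>M0 x y. M = M0 + {#x#} \<and> M' = M0 + {#y#} \<and> p dvd y - x)"

lemma mergesI: "M = M0 + {#x, y#} \<Longrightarrow> M' = M0 + {#z#} \<Longrightarrow> m dvd z - (x + y) \<Longrightarrow> merges m M M'"
  unfolding merges_def by blast

lemma shiftsI: "M = M0 + {#x#} \<Longrightarrow> M' = M0 + {#y#} \<Longrightarrow> p dvd y - x \<Longrightarrow> shifts p M M'"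
  unfolding shifts_def by blast

section \<open>Effect of the three moves on the cost\<close>

lemma dvd_of_dvd_diff: "(m::int) dvd a - b \<Longrightarrow> m dvd b \<longleftrightarrow> m dvd a"
  using dvd_diff_commute by (metis diff_add_cancel dvd_add_right_iff)

lemma null_partition_memE:
  assumes "null_partition p (add_mset x M) D"
  obtains B D0 where "D = add_mset (add_mset x B) D0" "M = B + \<Sum>\<^sub># D0"
    "p dvd x + \<Sum>\<^sub># B" "\<And>C. C \<in># D0 \<Longrightarrow> C \<noteq> {#} \<and> p dvd \<Sum>\<^sub># C"
proof -
  have "x \<in># \<Sum>\<^sub># D" using assms by (simp add: null_partition_def)
  then obtain C where C: "C \<in># D" "x \<in># C" by auto
  then obtain D0 where D0: "D = add_mset C D0" by (meson multi_member_split)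
  obtain B where B: "C = add_mset x B" using C by (meson multi_member_split)
  show thesis
    by (rule that[of B D0]) (use assms in \<open>auto simp: null_partition_def D0 B\<close>)
qed

text \<open>The block of \<open>x\<close> keeps its size, and its sum stays divisible by
  \<open>p\<close>; only the saving for a null sum can be lost.\<close>

lemma cost_shift:
  assumes "shifts p M M'" "null_partition p M D"
  shows "\<exists>D'. null_partition p M' D' \<and> cost m D' \<le> cost m D + 1"
proof -
  obtain M0 x y where M: "M = add_mset x M0" "M' = add_mset y M0" "p dvd y - x"
    using assms(1) by (auto simp: shifts_def)
  from null_partition_memE[OF assms(2)[unfolded M(1)]] obtain B D0 where
    D: "D = add_mset (add_mset x B) D0" "M0 = B + \<Sum>\<^sub># D0" "p dvd x + \<Sum>\<^sub># B"
      "\<And>C. C \<in># D0 \<Longrightarrow> C \<noteq> {#} \<and> p dvd \<Sum>\<^sub># C" by metis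
  have "p dvd y + \<Sum>\<^sub># B" 
    using dvd_add[OF M(3) D(3)] by (simp add: algebra_simps)
  then show ?thesis using D M
    by (intro exI[of _ "add_mset (add_mset y B) D0"])
      (auto simp: null_partition_def block_cost_def)
qed

text \<open>Putting \<open>x\<close> and \<open>y\<close> into the block of \<open>z\<close>
  preserves its sum modulo \<open>m\<close>; the size grows by 1.\<close>

lemma cost_unmerge:
  assumes "p dvd m" "merges m M' M" "null_partition p M D"
  shows "\<exists>D'. null_partition p M' D' \<and> cost m D' \<le> cost m D + 1"
proof -
  obtain M0 x y z where M: "M = add_mset z M0" "M' = add_mset x (add_mset y M0)" "m dvd z - (x + y)"
    using assms(2) by (auto simp: merges_def)
  from null_partition_memE[OF assms(3)[unfolded M(1)]] obtain B D0 where
    D: "D = add_mset (add_mset z B) D0" "M0 = B + \<Sum>\<^sub># D0" "p dvd z + \<Sum>\<^sub># B"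
      "\<And>C. C \<in># D0 \<Longrightarrow> C \<noteq> {#} \<and> p dvd \<Sum>\<^sub># C" by metis
  have m: "m dvd z + \<Sum>\<^sub># B \<longleftrightarrow> m dvd x + (y + \<Sum>\<^sub># B)"
    using M(3) by (intro dvd_of_dvd_diff[symmetric]) (simp add: algebra_simps)
  have "p dvd x + (y + \<Sum>\<^sub># B)"
    using D(3) dvd_of_dvd_diff[of p "z + \<Sum>\<^sub># B" "x + (y + \<Sum>\<^sub># B)"] 
      dvd_trans[OF assms(1) M(3)] by (simp add: algebra_simps)
  then show ?thesis using D M m
    by (intro exI[of _ "add_mset (add_mset x (add_mset y B)) D0"])
      (auto simp: null_partition_def block_cost_def)
qed

lemma cost_merge_same_block:
  assumes "p dvd m" "null_partition p M (add_mset (B + {#x, y#}) D)" "m dvd z - (x + y)"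
  shows "null_partition p (B + \<Sum>\<^sub># D + {#z#}) (add_mset (B + {#z#}) D)"
    and "cost m (add_mset (B + {#z#}) D) = cost m (add_mset (B + {#x, y#}) D) - 1"
    and "M = B + \<Sum>\<^sub># D + {#x, y#}"
proof -
  have m: "m dvd z + \<Sum>\<^sub># B \<longleftrightarrow> m dvd x + (y + \<Sum>\<^sub># B)"
    using assms(3) by (intro dvd_of_dvd_diff[symmetric]) (simp add: algebra_simps)
  have "p dvd z + \<Sum>\<^sub># B \<longleftrightarrow> p dvd x + (y + \<Sum>\<^sub># B)"
    using dvd_trans[OF assms(1,3)]
    by (intro dvd_of_dvd_diff[symmetric]) (simp add: algebra_simps)
  then show "null_partition p (B + \<Sum>\<^sub># D + {#z#}) (add_mset (B + {#z#}) D)"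
    using assms(2) by (auto simp: null_partition_def)
  show "cost m (add_mset (B + {#z#}) D) = cost m (add_mset (B + {#x, y#}) D) - 1"
    using m by (simp add: block_cost_def)
  show "M = B + \<Sum>\<^sub># D + {#x, y#}"
    using assms(2) by (simp add: null_partition_def)
qed

lemma cost_merge:
  assumes "p dvd m" "merges m M M'" "null_partition p M D"
  shows "\<exists>D'. null_partition p M' D' \<and> cost m D' \<le> cost m D + 1"
proof -
  obtain M0 x y z where M: "M = add_mset x (add_mset y M0)" "M' = add_mset z M0" "m dvd z - (x + y)"
    using assms(2) by (auto simp: merges_def)
  from null_partition_memE[OF assms(3)[unfolded M(1)]] obtain B D0 where
    D: "D = add_mset (add_mset x B) D0" "add_mset y M0 = B + \<Sum>\<^sub># D0" "p dvd x + \<Sum>\<^sub># B"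
      "\<And>C. C \<in># D0 \<Longrightarrow> C \<noteq> {#} \<and> p dvd \<Sum>\<^sub># C" by metis
  have "y \<in># B + \<Sum>\<^sub># D0" using D(2) by (metis union_single_eq_member)
  then consider "y \<in># B" | "y \<in># \<Sum>\<^sub># D0" by auto
  then show ?thesis
  proof cases
    case 1
    then obtain B' where B': "B = add_mset y B'" by (meson multi_member_split)
    have np: "null_partition p M (add_mset (B' + {#x, y#}) D0)"
      using assms(3) by (simp add: D(1) B' add_mset_commute)
    have "M0 = B' + \<Sum>\<^sub># D0" using D(2) B' by simp
    then show ?thesis
      using cost_merge_same_block[OF assms(1) np M(3)] M(2) D(1) B'
      by (intro exI[of _ "add_mset (B' + {#z#}) D0"]) (simp add: add_mset_commute)
  next
    case 2
    have "null_partition p (add_mset y (\<Sum>\<^sub># D0 - {#y#})) D0"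
      using D(4) 2 by (auto simp: null_partition_def)
    from null_partition_memE[OF this] obtain C D1 where
      C: "D0 = add_mset (add_mset y C) D1" "p dvd y + \<Sum>\<^sub># C"
       "\<And>C. C \<in># D1 \<Longrightarrow> C \<noteq> {#} \<and> p dvd \<Sum>\<^sub># C" by metis
    have M0: "M0 = B + C + \<Sum>\<^sub># D1" using D(2) C(1) by simp
    have *: "z + \<Sum>\<^sub># (B + C) - ((x + \<Sum>\<^sub># B) + (y + \<Sum>\<^sub># C)) = z - (x + y)"
      by simp
    have p: "p dvd z + \<Sum>\<^sub># (B + C)"
      using dvd_trans[OF assms(1) M(3)] dvd_add[OF D(3) C(2)] dvd_of_dvd_diff * by metis
    \<comment> \<open>When two blocks are joined, the total size and the number of blocks both drop
      by 1, so only the savings for null sums matter. Two null sums give a null sum of the union,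
      hence at most one saving is lost.\<close>
    have m: "m dvd z + \<Sum>\<^sub># (B + C)" if "m dvd x + \<Sum>\<^sub># B" "m dvd y + \<Sum>\<^sub># C"
      using M(3) dvd_add[OF that] dvd_of_dvd_diff * by metis
    show ?thesis using p m M0 M(2) C D(1)
      by (intro exI[of _ "add_mset (add_mset z (B + C)) D1"])
        (auto simp: null_partition_def block_cost_def)
  qed
qed

text \<open>Two weights in a common block can be merged at a gain of 1; if no two share a block, all
  blocks are singletons. The gain is stated for every \<open>z\<close> congruent to
  \<open>x + y\<close>, because the reflection realising the merge determines the
  representative.\<close>

lemma null_partition_descent:
  assumes "p dvd m" "null_partition p M D"
  obtains (merge) M0 x y where "M = M0 + {#x, y#}"
      "\<And>z. m dvd z - (x + y) \<Longrightarrow> \<exists>D'. null_partition p (M0 + {#z#}) D' \<and> cost m D' = cost m D - 1"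
  | (single) "\<And>x. x \<in># M \<Longrightarrow> p dvd x" "cost m D = - int (zeros m M)"
proof (cases "\<exists>B\<in>#D. size B \<ge> 2")
  case True
  then obtain B where B: "B \<in># D" "size B \<ge> 2" by auto
  then obtain D0 where D: "D = add_mset B D0" by (meson multi_member_split)
  obtain x y B' where B': "B = B' + {#x, y#}" using size_ge_2E[OF B(2)] .
  have np: "null_partition p M (add_mset (B' + {#x, y#}) D0)" using assms(2) D B' by simp
  show thesis
  proof (rule merge[of "B' + \<Sum>\<^sub># D0" x y])
    fix z assume z: "m dvd z - (x + y)"
    show "\<exists>D'. null_partition p (B' + \<Sum>\<^sub># D0 + {#z#}) D' \<and> cost m D' = cost m D - 1"
      using cost_merge_same_block(1,2)[OF assms(1) np z] unfolding D B' by (intro exI conjI)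
  qed (use cost_merge_same_block(3)[OF assms(1) np, of "x + y"] in simp)
next
  case False
  have s: "\<exists>x. B = {#x#} \<and> p dvd x" if "B \<in># D" for B
  proof -
    have "B \<noteq> {#}" "p dvd \<Sum>\<^sub># B" "\<not> size B \<ge> 2" using False assms(2) that by (auto simp: null_partition_def)
    then have "size B = 1" by (cases "size B") auto
    then obtain x where "B = {#x#}" using size_1_singleton_mset by blast
    then show ?thesis using \<open>p dvd \<Sum>\<^sub># B\<close> by simp
  qed
  have "(\<forall>x\<in>#\<Sum>\<^sub># D. p dvd x) \<and> cost m D = - int (zeros m (\<Sum>\<^sub># D))"
    using s
  proof (induction D)
    case (add B D)
    obtain x where "B = {#x#}" "p dvd x" using add.prems[of B] by auto
    then show ?case using add by (auto simp: block_cost_def)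
  qed simp
  then show thesis using assms(2) by (intro single) (auto simp: null_partition_def)
qed

text \<open>In an optimal partition a block \<open>B' + {#x, y#}\<close> with \<open>m dvd x + y\<close>, \<open>\<not> m dvd x\<close> and
  nonempty \<open>B'\<close> would be split, so every block that is not a null pair or a singleton offers a
  merge which does not increase the number of null weights.\<close>
lemma bad_merge_if_not_paired:
  assumes "p dvd m" "null_partition p M D" "\<not> paired m p M"
    and opt: "\<And>D'. null_partition p M D' \<Longrightarrow> cost m D \<le> cost m D'"
  obtains M0 x y where "M = M0 + {#x, y#}"
      "\<And>z. m dvd z - (x + y) \<Longrightarrow> \<exists>D'. null_partition p (M0 + {#z#}) D' \<and> cost m D' = cost m D - 1"
      "\<And>z. m dvd z - (x + y) \<Longrightarrow> zeros m (M0 + {#z#}) \<le> zeros m M"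
proof -
  have "\<exists>B\<in>#D. \<not> paired m p B"
    using paired_sum_mset[of D m p] assms(2,3) by (auto simp: null_partition_def)
  then obtain B where B: "B \<in># D" "\<not> paired m p B" by auto
  then obtain D0 where D: "D = add_mset B D0" by (meson multi_member_split)
  have Bp: "B \<noteq> {#}" "p dvd \<Sum>\<^sub># B" using B assms(2) by (auto simp: null_partition_def)
  then obtain x B1 where B1: "B = add_mset x B1" by (meson multiset_cases)
  have "B1 \<noteq> {#}" using B Bp B1 paired.single[OF paired.empty, of p x m] by auto
  then obtain y B' where "B1 = add_mset y B'" by (meson multiset_cases)
  then have B': "B = B' + {#x, y#}" using B1 by (simp add: add_mset_commute)
  have np: "null_partition p M (add_mset (B' + {#x, y#}) D0)" using assms(2) D B' by simp
  have xy: "\<not> m dvd x + y \<or> m dvd x"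
  proof (rule ccontr)
    assume "\<not> ?thesis"
    then have xy: "m dvd x + y" "\<not> m dvd x" by auto
    have "B' \<noteq> {#}" using B B' xy paired.pair[OF paired.empty, of m x y p] by auto
    moreover have "p dvd \<Sum>\<^sub># B'" 
      using Bp B' dvd_trans[OF assms(1) xy(1)] by (simp add: dvd_add_right_iff add.assoc[symmetric])
    ultimately have "null_partition p M (add_mset B' (add_mset {#x, y#} D0))"
      using np dvd_trans[OF assms(1) xy(1)] by (auto simp: null_partition_def)
    moreover have "m dvd \<Sum>\<^sub># B' \<longleftrightarrow> m dvd \<Sum>\<^sub># B"
      using xy(1) B' by (simp add: dvd_add_right_iff add.assoc[symmetric])
    then have "cost m (add_mset B' (add_mset {#x, y#} D0)) = cost m D - 2"
      using xy(1) D B' by (simp add: block_cost_def)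
    ultimately show False using opt by force
  qed
  show thesis
  proof (rule that[of "B' + \<Sum>\<^sub># D0" x y])
    fix z assume z: "m dvd z - (x + y)"
    \<comment> \<open>If \<open>z\<close> is null, then so is \<open>x + y\<close> and, by
      \<open>xy\<close>, both \<open>x\<close> and \<open>y\<close>: two null weights become one.
      Otherwise no null weight is created.\<close>
    have "m dvd z \<longleftrightarrow> m dvd x + y" using dvd_of_dvd_diff[OF z] by simp
    then show "zeros m (B' + \<Sum>\<^sub># D0 + {#z#}) \<le> zeros m M"
      using xy cost_merge_same_block(3)[OF assms(1) np z] by auto
    show "\<exists>D'. null_partition p (B' + \<Sum>\<^sub># D0 + {#z#}) D' \<and> cost m D' = cost m D - 1"
      using cost_merge_same_block(1,2)[OF assms(1) np z] unfolding D B' by (intro exI conjI)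
  qed (use cost_merge_same_block(3)[OF assms(1) np, of "x + y"] in simp)
qed

lemma paired_if_all_dvd: "(\<And>x. x \<in># M \<Longrightarrow> p dvd x) \<Longrightarrow> paired m p M"
proof (induction M)
  case (add x M)
  then show ?case using paired.single[of m p M x] by simp
qed (rule paired.empty)

lemma paired_remove_null:
  assumes "p dvd m" "paired m p (A + Z)" "\<And>z. z \<in># Z \<Longrightarrow> m dvd z"
  shows "paired m p A"
proof -
  let ?N = "filter_mset (\<lambda>x. \<not> m dvd x) A" and ?Z = "filter_mset (\<lambda>x. m dvd x) A"
  have Z: "filter_mset (\<lambda>x. \<not> m dvd x) Z = {#}" using assms(3) by auto
  have "paired m p ?N" using paired_cancel_null[OF assms(2)] unfolding filter_union_mset Z by simp
  moreover have "paired m p ?Z" using assms(1) by (intro paired_if_all_dvd) (auto intro: dvd_trans)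
  moreover have "A = ?N + ?Z" by (metis multiset_partition union_commute)
  ultimately show ?thesis using paired_add by metis
qed

section \<open>Nonnull weights when a null weight is lost\<close>

abbreviation nonnull :: "int \<Rightarrow> int multiset \<Rightarrow> int multiset" where
  "nonnull m M \<equiv> filter_mset (\<lambda>x. \<not> m dvd x) M"

lemma nonnull_shifts:
  assumes "shifts p M M'" "zeros m M = Suc (zeros m M')"
  shows "nonnull m M \<subseteq># nonnull m M'"
proof -
  obtain M0 x y where "M = M0 + {#x#}" "M' = M0 + {#y#}" using assms(1) by (auto simp: shifts_def)
  then show ?thesis using assms(2) by (auto simp: of_bool_def split: if_splits)
qed

lemma eq_if_dvd_diff: "\<lbrakk>0 \<le> x; x < m; 0 \<le> y; y < m; (m::int) dvd x - y\<rbrakk> \<Longrightarrow> x = y"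
  by (metis mod_eq_dvd_iff mod_pos_pos_trivial)

text \<open>Losing a null weight forces \<open>x\<close> or \<open>y\<close> to be null, so
  \<open>z\<close> is congruent to the other one. The range hypothesis turns this congruence into
  equality.\<close>

lemma nonnull_merges:
  assumes "merges m M M'" "zeros m M = Suc (zeros m M')"
    and "\<And>x. x \<in># M + M' \<Longrightarrow> 0 \<le> x \<and> x < m"
  shows "nonnull m M \<subseteq># nonnull m M'"
proof -
  obtain M0 x y z where M: "M = M0 + {#x, y#}" "M' = M0 + {#z#}" "m dvd z - (x + y)"
    using assms(1) by (auto simp: merges_def)
  have rng: "0 \<le> x" "x < m" "0 \<le> y" "y < m" "0 \<le> z" "z < m" using assms(3) M(1,2) by auto
  have "m dvd x \<or> m dvd y" using assms(2) M(1,2) by (auto simp: of_bool_def split: if_splits)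
  then show ?thesis
  proof
    assume x: "m dvd x"
    have "m dvd z - y" using dvd_add[OF M(3) x] by simp
    then have "z = y" using rng eq_if_dvd_diff by simp
    then show ?thesis using x M by simp
  next
    assume y: "m dvd y"
    have "m dvd z - x" using dvd_add[OF M(3) y] by simp
    then have "z = x" using rng eq_if_dvd_diff by simp
    then show ?thesis using y M by simp
  qed
qed

text \<open>Here \<open>M'\<close> arises from \<open>M\<close> by a split. The count drops only if
  \<open>z\<close> is null while \<open>x\<close> and \<open>y\<close> are not, so \<open>M'\<close>
  gains two nonnull weights.\<close>

lemma nonnull_unmerges:
  assumes "merges m M' M" "zeros m M = Suc (zeros m M')"
  shows "nonnull m M \<subseteq># nonnull m M'"
proof -
  obtain M0 x y z where M: "M' = M0 + {#x, y#}" "M = M0 + {#z#}"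
    using assms(1) by (auto simp: merges_def)
  then have "m dvd z" using assms(2) by (auto simp: of_bool_def split: if_splits)
  then show ?thesis using M by (auto intro: subset_mset.order_trans[OF _ mset_subset_eq_add_right])
qed

section \<open>Cycles of a permutation\<close>

definition cyc :: "(nat \<Rightarrow> nat) \<Rightarrow> nat \<Rightarrow> nat set" where
  "cyc u i = {(u ^^ k) i |k. True}"

lemma cycles_of_eq: "cycles_of n u = cyc u ` {..<n}"
  by (auto simp: cycles_of_def cyc_def)

lemma cyc_self [simp]: "i \<in> cyc u i"
  unfolding cyc_def by (auto intro: exI[of _ 0])

lemma funpow_in_cyc [simp]: "(u ^^ k) i \<in> cyc u i"
  by (auto simp: cyc_def)

lemma cyc_step: "x \<in> cyc u i \<Longrightarrow> u x \<in> cyc u i"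
  unfolding cyc_def by (auto intro: exI[of _ "Suc k" for k])

lemma cyc_least: "i \<in> S \<Longrightarrow> (\<And>x. x \<in> S \<Longrightarrow> u x \<in> S) \<Longrightarrow> cyc u i \<subseteq> S"
proof -
  assume *: "i \<in> S" "\<And>x. x \<in> S \<Longrightarrow> u x \<in> S"
  have "(u ^^ k) i \<in> S" for k using * by (induction k) auto
  then show ?thesis by (auto simp: cyc_def)
qed

lemma cyc_trans: "j \<in> cyc u i \<Longrightarrow> cyc u j \<subseteq> cyc u i"
  by (rule cyc_least) (auto intro: cyc_step)

lemma funpow_period:
  fixes u :: "nat \<Rightarrow> nat"
  assumes "u permutes {..<n}"
  obtains k where "k > 0" "u ^^ k = id"
  using permutation_is_nilpotent[OF permutes_imp_permutation[OF _ assms]] that by auto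

lemma cyc_sym:
  assumes "u permutes {..<n}" "j \<in> cyc u i"
  shows "i \<in> cyc u j"
proof -
  obtain l where l: "j = (u ^^ l) i" using assms by (auto simp: cyc_def)
  obtain k where k: "k > 0" "u ^^ k = id" using funpow_period[OF assms(1)] .
  \<comment> \<open>Since \<open>u ^^ k = id\<close> with \<open>k > 0\<close>, the inverse of
    \<open>u ^^ l\<close> is the forward power \<open>k * l - l\<close>.\<close>
  have "(u ^^ (k * l - l)) j = (u ^^ (k * l)) i"
    using k(1) by (simp add: l funpow_add[symmetric, THEN fun_cong, unfolded o_def])
  also have "\<dots> = i" using k(2) by (simp add: funpow_mult[symmetric])
  finally show ?thesis using funpow_in_cyc[of "k * l - l" u j] by simp
qed

lemma cyc_eq:
  assumes "u permutes {..<n}" "j \<in> cyc u i"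
  shows "cyc u j = cyc u i"
  using assms cyc_trans cyc_sym by (metis subset_antisym)

lemma cyc_bound:
  assumes "u permutes {..<n}" "i < n"
  shows "cyc u i \<subseteq> {..<n}"
  using assms by (intro cyc_least) (auto dest: permutes_in_image)

lemma cyc_disjoint:
  assumes "u permutes {..<n}" "x \<in> cyc u i" "x \<in> cyc u j"
  shows "cyc u i = cyc u j"
  using assms cyc_eq by metis

lemma finite_cycles_of [simp]: "finite (cycles_of n u)"
  by (simp add: cycles_of_eq)

lemma card_cycles_of_le: "card (cycles_of n u) \<le> n"
  unfolding cycles_of_eq using card_image_le[of "{..<n}" "cyc u"] by simp

lemma cycles_of_memD: "u permutes {..<n} \<Longrightarrow> C \<in> cycles_of n u \<Longrightarrow> i \<in> C \<Longrightarrow> C = cyc u i"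
  using cyc_eq by (metis cycles_of_eq imageE)

lemma cycles_of_bound:
  "u permutes {..<n} \<Longrightarrow> C \<in> cycles_of n u \<Longrightarrow> C \<subseteq> {..<n}"
  by (auto simp: cycles_of_eq dest: cyc_bound)

lemma finite_cycle: "u permutes {..<n} \<Longrightarrow> C \<in> cycles_of n u \<Longrightarrow> finite C"
  by (rule finite_subset[OF cycles_of_bound]) auto

lemma partition_on_cycles_of:
  assumes "u permutes {..<n}"
  shows "partition_on {..<n} (cycles_of n u)"
proof (rule partition_onI)
  show "\<Union> (cycles_of n u) = {..<n}"
  proof
    show "\<Union> (cycles_of n u) \<subseteq> {..<n}" by (intro Union_least cycles_of_bound[OF assms])
    show "{..<n} \<subseteq> \<Union> (cycles_of n u)" unfolding cycles_of_eq using cyc_self by blast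
  qed
  show "disjnt C C'" if "C \<in> cycles_of n u" "C' \<in> cycles_of n u" "C \<noteq> C'" for C C'
    using that cycles_of_memD[OF assms] by (metis disjnt_iff)
  show "{} \<notin> cycles_of n u" unfolding cycles_of_eq using cyc_self by blast
qed

lemma card_cycles_of_eq_iff:
  assumes "u permutes {..<n}"
  shows "card (cycles_of n u) = n \<longleftrightarrow> u = id"
proof
  assume "card (cycles_of n u) = n"
  then have inj: "inj_on (cyc u) {..<n}"
    by (simp add: cycles_of_eq eq_card_imp_inj_on)
  have "u i = i" for i
  proof (cases "i < n")
    case True
    then have "u i < n" using assms permutes_in_image by fastforce
    moreover have "cyc u (u i) = cyc u i" using cyc_eq[OF assms cyc_step[OF cyc_self]] .
    ultimately show ?thesis using inj True by (auto dest: inj_onD)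
  qed (use assms in \<open>auto simp: permutes_def\<close>)
  then show "u = id" by auto
next
  assume "u = id"
  then have "cyc u i = {i}" for i by (auto simp: cyc_def)
  then show "card (cycles_of n u) = n" by (simp add: cycles_of_eq card_image)
qed

lemma transpose_permutes:
  "u permutes {..<n} \<Longrightarrow> i < n \<Longrightarrow> j < n \<Longrightarrow> u \<circ> transpose i j permutes {..<n}"
  by (intro permutes_compose permutes_swap_id) auto

text \<open>From \<open>i\<close> the permutation \<open>v\<close> jumps to \<open>u j\<close>,
  follows the old cycle of \<open>j\<close> until it reaches \<open>j\<close>, and continues at
  \<open>u i\<close>. Were \<open>j\<close> never reached, \<open>v\<close> would agree with
  \<open>u\<close> along the whole \<open>u\<close>-orbit of \<open>u j\<close>, which does return
  to \<open>j\<close>.\<close>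

lemma cyc_merge:
  assumes u: "u permutes {..<n}" and ij: "i < n" "j < n" "j \<notin> cyc u i"
  defines "v \<equiv> u \<circ> transpose i j"
  shows "cyc v i = cyc u i \<union> cyc u j"
    and "c \<notin> cyc u i \<union> cyc u j \<Longrightarrow> cyc v c = cyc u c"
proof -
  have v: "v permutes {..<n}" using u ij by (simp add: v_def transpose_permutes)
  have ne: "i \<notin> cyc u j" using cyc_sym[OF u] ij by blast
  have vx: "v x = u x" if "x \<noteq> i" "x \<noteq> j" for x using that by (simp add: v_def)
  have vi: "v i = u j" "v j = u i" by (simp_all add: v_def)
  have "j \<in> cyc v i"
  proof (rule ccontr)
    assume n: "j \<notin> cyc v i"
    have "(u ^^ Suc k) j \<in> cyc v i" for k
    proof (induction k)
      case 0
      then show ?case using cyc_step[OF cyc_self, of v i] vi by simp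
    next
      case (Suc k)
      have "(u ^^ Suc k) j \<noteq> i" using ne funpow_in_cyc by metis
      moreover have "(u ^^ Suc k) j \<noteq> j" using Suc n by metis
      ultimately have "v ((u ^^ Suc k) j) = u ((u ^^ Suc k) j)" by (rule vx)
      then show ?case using cyc_step[OF Suc] by simp
    qed
    moreover obtain k where "k > 0" "u ^^ k = id" using funpow_period[OF u] .
    ultimately show False using n by (metis Suc_pred id_apply)
  qed
  \<comment> \<open>Both \<open>i\<close> and \<open>j\<close> lie in \<open>cyc v i\<close>, so
    this set is closed under the transposition and hence under \<open>u\<close>.\<close>
  have "u x \<in> cyc v i" if "x \<in> cyc v i" for x
  proof -
    have "transpose i j x \<in> cyc v i" using that \<open>j \<in> cyc v i\<close> by (simp add: transpose_def)
    from cyc_step[OF this] show ?thesis by (simp add: v_def)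
  qed
  then have "cyc u i \<union> cyc u j \<subseteq> cyc v i"
    using \<open>j \<in> cyc v i\<close> cyc_least[of _ "cyc v i" u] by (metis Un_least cyc_self)
  moreover have "cyc v i \<subseteq> cyc u i \<union> cyc u j"
  proof (rule cyc_least)
    fix x assume "x \<in> cyc u i \<union> cyc u j"
    then have "transpose i j x \<in> cyc u i \<union> cyc u j" by (auto simp: transpose_def)
    then show "v x \<in> cyc u i \<union> cyc u j" by (auto simp: v_def dest: cyc_step)
  qed simp
  ultimately show "cyc v i = cyc u i \<union> cyc u j" by auto
  assume c: "c \<notin> cyc u i \<union> cyc u j"
  have "(v ^^ k) c = (u ^^ k) c" for k
  proof (induction k)
    case (Suc k)
    have "(u ^^ k) c \<noteq> i" "(u ^^ k) c \<noteq> j"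
      using c cyc_sym[OF u] funpow_in_cyc[of k u c] by (metis UnI1, metis UnI2)
    then show ?case using Suc vx by simp
  qed simp
  then show "cyc v c = cyc u c" by (simp add: cyc_def)
qed

lemma cycles_of_merge:
  assumes u: "u permutes {..<n}" and ij: "i < n" "j < n" "j \<notin> cyc u i"
  shows "cycles_of n (u \<circ> transpose i j) =
    insert (cyc u i \<union> cyc u j) (cycles_of n u - {cyc u i, cyc u j})" (is "cycles_of n ?v = ?R")
proof -
  have v: "?v permutes {..<n}" using u ij by (simp add: transpose_permutes)
  have eq: "cyc ?v c = (if c \<in> cyc u i \<union> cyc u j then cyc u i \<union> cyc u j else cyc u c)" for c
    using cyc_merge[OF u ij] cyc_eq[OF v, of c i] by auto
  have "cyc u c \<in> {cyc u i, cyc u j} \<longleftrightarrow> c \<in> cyc u i \<union> cyc u j" for c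
    using cyc_eq[OF u, of c] cyc_self[of c u] by (metis Un_iff insert_iff empty_iff)
  then show ?thesis
    using ij(1) by (auto simp: cycles_of_eq eq)
qed

text \<open>Let \<open>k\<close> be the distance from \<open>i\<close> to \<open>j\<close> along
  \<open>u\<close>. The points \<open>(u ^^ r) i\<close> with \<open>1 <= r <= k\<close> are closed
  under the new permutation, since it sends \<open>j\<close> back to \<open>u i\<close>. They
  include \<open>j\<close> but not \<open>i\<close>.\<close>

lemma cyc_split:
  assumes u: "u permutes {..<n}" and ij: "i < n" "j < n" "i \<noteq> j" "j \<in> cyc u i"
  shows "j \<notin> cyc (u \<circ> transpose i j) i"
proof -
  let ?v = "u \<circ> transpose i j"
  have v: "?v permutes {..<n}" using u ij by (simp add: transpose_permutes)
  define k where "k = (LEAST k. (u ^^ k) i = j)"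
  have k: "(u ^^ k) i = j" unfolding k_def using ij(4) by (auto simp: cyc_def intro: LeastI)
  have min: "(u ^^ l) i \<noteq> j" if "l < k" for l using that not_less_Least unfolding k_def by blast
  have "k > 0" using k ij by (cases k) auto
  let ?Y = "(\<lambda>r. (u ^^ r) i) ` {1..k}"
  \<comment> \<open>A return to \<open>i\<close> after \<open>r\<close> steps would bring
    \<open>j\<close> into reach after \<open>k - r\<close> steps, against the minimality of
    \<open>k\<close>.\<close>
  have "(u ^^ r) i \<noteq> i" if "1 \<le> r" "r \<le> k" for r
  proof
    assume r: "(u ^^ r) i = i"
    have "(u ^^ (k - r)) i = (u ^^ (k - r + r)) i" using r by (simp add: funpow_add del: le_add_diff_inverse2)
    then show False using k min[of "k - r"] that by simp
  qed
  then have i: "i \<notin> ?Y" by fastforce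
  have "cyc ?v j \<subseteq> ?Y"
  proof (rule cyc_least)
    show "j \<in> ?Y" using k \<open>k > 0\<close> by (auto intro: rev_image_eqI[of k])
    fix x assume "x \<in> ?Y"
    then obtain r where r: "1 \<le> r" "r \<le> k" "x = (u ^^ r) i" by auto
    show "?v x \<in> ?Y"
    proof (cases "r = k")
      case True
      then show ?thesis using k r \<open>k > 0\<close> by (auto intro!: rev_image_eqI[of 1])
    next
      case False
      then have "x \<noteq> j" using r min[of r] by simp
      moreover have "x \<noteq> i" using i \<open>x \<in> ?Y\<close> by metis
      ultimately have "?v x = u x" by simp
      then show ?thesis using r False by (auto intro!: rev_image_eqI[of "Suc r"])
    qed
  qed
  then show ?thesis using i cyc_sym[OF v] by blast
qed

section \<open>Cycle weights\<close>

text \<open>Reduction modulo \<open>m\<close> picks one representative of each weight, so that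
  inclusions of multisets are meaningful in Z/mZ.\<close>

definition cycle_weights :: "nat \<Rightarrow> nat \<Rightarrow> (nat \<Rightarrow> nat) \<Rightarrow> (nat \<Rightarrow> int) \<Rightarrow> int multiset" where
  "cycle_weights m n u a = image_mset (\<lambda>C. wt a C mod int m) (mset_set (cycles_of n u))"

text \<open>The weights \<open>k\<close> and \<open>- k\<close> make the 2-cycle on \<open>i\<close>
  and \<open>j\<close> null. Together with \<open>transpose i j\<close> they describe every
  reflection whose underlying permutation is not the identity.\<close>

definition swap_wt :: "nat \<Rightarrow> nat \<Rightarrow> int \<Rightarrow> nat \<Rightarrow> int" where
  "swap_wt i j k c = (if c = i then k else if c = j then - k else 0)"

definition unit_wt :: "nat \<Rightarrow> int \<Rightarrow> nat \<Rightarrow> int" where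
  "unit_wt i k c = (if c = i then k else 0)"

lemma wt_cong_mod:
  assumes "\<And>i. i \<in> I \<Longrightarrow> a i mod k = b i mod k"
  shows "wt a I mod k = wt b I mod k"
proof -
  have "(\<Sum>i\<in>I. a i mod k) = (\<Sum>i\<in>I. b i mod k)" using assms by (rule sum.cong[OF refl])
  then show ?thesis unfolding wt_def by (metis mod_sum_eq)
qed

lemma cycle_weights_cong:
  assumes u: "u permutes {..<n}" and "\<And>i. i < n \<Longrightarrow> a i mod int m = b i mod int m"
  shows "cycle_weights m n u a = cycle_weights m n u b"
  unfolding cycle_weights_def
proof (rule image_mset_cong)
  fix C assume "C \<in># mset_set (cycles_of n u)"
  then have "C \<subseteq> {..<n}" using cycles_of_bound[OF u] by simp
  then show "wt a C mod int m = wt b C mod int m" using assms(2) by (intro wt_cong_mod) auto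
qed

lemma size_cycle_weights: "size (cycle_weights m n u a) = card (cycles_of n u)"
  by (simp add: cycle_weights_def)

lemma wt_eq_sum_cycles:
  assumes "u permutes {..<n}"
  shows "wt a {..<n} = (\<Sum>C\<in>cycles_of n u. wt a C)"
proof -
  have "wt a (\<Union> (cycles_of n u)) = (\<Sum>C\<in>cycles_of n u. wt a C)"
    unfolding wt_def
    using partition_onD2[OF partition_on_cycles_of[OF assms]] finite_cycle[OF assms]
    by (subst sum.Union_disjoint_sets) auto
  then show ?thesis using partition_onD1[OF partition_on_cycles_of[OF assms]] by simp
qed

lemma sum_mod_image_mset_dvd:
  assumes "p dvd m" "finite S"
  shows "int p dvd \<Sum>\<^sub># (image_mset (\<lambda>C. f C mod int m) (mset_set S)) \<longleftrightarrow> int p dvd (\<Sum>C\<in>S. f C)"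
proof -
  have "\<Sum>\<^sub># (image_mset (\<lambda>C. f C mod int m) (mset_set S)) = (\<Sum>C\<in>S. f C mod int m)"
    by (simp add: sum_unfold_sum_mset)
  also have "\<dots> mod int p = (\<Sum>C\<in>S. f C mod int m mod int p) mod int p" by (simp add: mod_sum_eq)
  also have "\<dots> = (\<Sum>C\<in>S. f C) mod int p"
    using assms(1) by (simp add: mod_mod_cancel mod_sum_eq)
  finally show ?thesis by (simp add: dvd_eq_mod_eq_0)
qed

lemma dvd_sum_cycle_weights:
  assumes "u permutes {..<n}" "p dvd m"
  shows "int p dvd \<Sum>\<^sub># (cycle_weights m n u a) \<longleftrightarrow> int p dvd wt a {..<n}"
  unfolding cycle_weights_def wt_eq_sum_cycles[OF assms(1)]
  using assms(2) by (simp add: sum_mod_image_mset_dvd)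

lemma wt_swap:
  assumes "finite S" "i \<noteq> j" "i \<in> S \<longleftrightarrow> j \<in> S"
  shows "wt (\<lambda>c. swap_wt i j k c + a (transpose i j c)) S = wt a S"
proof -
  have "(\<Sum>c\<in>S. swap_wt i j k c) = (\<Sum>c\<in>S. (if c = i then k else 0) + (if c = j then - k else 0))"
    using assms(2) by (intro sum.cong) (auto simp: swap_wt_def)
  also have "\<dots> = 0" using assms by (simp add: sum.distrib)
  moreover have "(\<Sum>c\<in>S. a (transpose i j c)) = (\<Sum>c\<in>S. a c)"
  proof (rule sum.reindex_bij_betw)
    have "transpose i j permutes S \<or> (\<forall>c\<in>S. transpose i j c = c)"
      using assms(3) by (cases "i \<in> S") (auto intro: permutes_swap_id simp: transpose_def)
    then show "bij_betw (transpose i j) S S"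
      using permutes_imp_bij[of "transpose i j" S] by (auto simp: bij_betw_def inj_on_def)
  qed
  ultimately show ?thesis by (simp add: wt_def sum.distrib)
qed

lemma wt_unit:
  assumes "finite S"
  shows "wt (\<lambda>c. unit_wt i k c + a c) S = (if i \<in> S then k else 0) + wt a S"
  using assms by (simp add: wt_def unit_wt_def sum.distrib)

text \<open>The points \<open>i\<close> and \<open>j\<close> end up in one cycle, where
  \<open>k\<close> and \<open>- k\<close> cancel, so the new weight does not depend on
  \<open>k\<close>. Both multisets are written over the same \<open>M0\<close> to expose the
  change.\<close>

lemma cycle_weights_merge:
  fixes m :: nat and a :: "nat \<Rightarrow> int"
  assumes u: "u permutes {..<n}" and C: "C \<in> cycles_of n u" "C' \<in> cycles_of n u" "C \<noteq> C'"
    and ij: "i \<in> C" "j \<in> C'"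
  defines "M0 \<equiv> image_mset (\<lambda>C. wt a C mod int m) (mset_set (cycles_of n u - {C, C'}))"
  shows "cycle_weights m n u a = M0 + {#wt a C mod int m, wt a C' mod int m#}"
    and "cycle_weights m n (u \<circ> transpose i j) (\<lambda>c. swap_wt i j k c + a (transpose i j c))
      = M0 + {#(wt a C + wt a C') mod int m#}"
proof -
  have n: "i < n" "j < n" using ij C cycles_of_bound[OF u] by auto
  have CC: "C = cyc u i" "C' = cyc u j"
    using C ij cycles_of_memD[OF u] by blast+
  have nj: "j \<notin> cyc u i" using C CC cyc_eq[OF u] by metis
  have ne: "i \<noteq> j" using nj by auto
  have fin: "finite C" "finite C'" using C finite_cycle[OF u] by auto
  have dis: "C \<inter> C' = {}" using cyc_disjoint[OF u] C(3) CC by blast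
  let ?S = "cycles_of n u - {C, C'}"
  have "cycles_of n u = insert C (insert C' ?S)" using C by auto
  then have "mset_set (cycles_of n u) = add_mset C (add_mset C' (mset_set ?S))"
    using C(3) by (metis Diff_iff finite_Diff finite_cycles_of finite_insert insertCI insertE mset_set.insert)
  then show "cycle_weights m n u a = M0 + {#wt a C mod int m, wt a C' mod int m#}"
    by (simp add: cycle_weights_def M0_def add_mset_commute)
  let ?b = "\<lambda>c. swap_wt i j k c + a (transpose i j c)"
  \<comment> \<open>The multiset comes from a set of cycles, so the merged cycle must be seen to be
    new before it counts as an additional element.\<close>
  have notin: "C \<union> C' \<notin> ?S"
  proof
    assume "C \<union> C' \<in> ?S"
    then obtain c where c: "C \<union> C' = cyc u c" by (auto simp: cycles_of_eq)
    then have "cyc u i = cyc u c" "cyc u j = cyc u c" using cyc_eq[OF u] ij by blast+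
    then show False using C(3) CC by simp
  qed
  have "mset_set (cycles_of n (u \<circ> transpose i j)) = add_mset (C \<union> C') (mset_set ?S)"
    using notin by (simp add: cycles_of_merge[OF u n nj] CC)
  moreover have "wt ?b (C \<union> C') = wt a C + wt a C'"
    using wt_swap[of "C \<union> C'" i j k a] ij ne fin dis by (simp add: wt_def sum.union_disjoint)
  moreover have wt: "wt ?b D = wt a D" if "D \<in> ?S" for D
  proof -
    have "i \<notin> D" "j \<notin> D" using that CC cycles_of_memD[OF u] by blast+
    then show ?thesis using wt_swap[OF _ ne] that finite_cycle[OF u] by simp
  qed
  moreover have "image_mset (\<lambda>C. wt ?b C mod int m) (mset_set ?S) = M0"
    unfolding M0_def by (rule image_mset_cong) (simp add: wt)
  ultimately show "cycle_weights m n (u \<circ> transpose i j) ?b = M0 + {#(wt a C + wt a C') mod int m#}"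
    unfolding cycle_weights_def by simp
qed

lemma cycle_weights_shift:
  fixes m :: nat and a :: "nat \<Rightarrow> int"
  assumes u: "u permutes {..<n}" and C: "C \<in> cycles_of n u" and i: "i \<in> C"
  defines "M0 \<equiv> image_mset (\<lambda>C. wt a C mod int m) (mset_set (cycles_of n u - {C}))"
  shows "cycle_weights m n u a = M0 + {#wt a C mod int m#}"
    and "cycle_weights m n u (\<lambda>c. unit_wt i k c + a c) = M0 + {#(k + wt a C) mod int m#}"
proof -
  let ?S = "cycles_of n u - {C}"
  have "mset_set (cycles_of n u) = add_mset C (mset_set ?S)"
    using C by (simp add: mset_set.remove)
  moreover have wt: "wt (\<lambda>c. unit_wt i k c + a c) D = wt a D" if "D \<in> ?S" for D
  proof -
    have "i \<notin> D" using that C i cycles_of_memD[OF u] by blast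
    then show ?thesis using wt_unit that finite_cycle[OF u] by simp
  qed
  moreover have "wt (\<lambda>c. unit_wt i k c + a c) C = k + wt a C"
    using i finite_cycle[OF u C] by (simp add: wt_unit)
  moreover have "image_mset (\<lambda>C. wt (\<lambda>c. unit_wt i k c + a c) C mod int m) (mset_set ?S) = M0"
    unfolding M0_def by (rule image_mset_cong) (simp add: wt)
  ultimately show "cycle_weights m n u a = M0 + {#wt a C mod int m#}"
    "cycle_weights m n u (\<lambda>c. unit_wt i k c + a c) = M0 + {#(k + wt a C) mod int m#}"
    unfolding cycle_weights_def by (simp_all add: M0_def)
qed

section \<open>Monomial matrices and their fixed spaces\<close>

lemma zeta_nonzero [simp]: "zeta m \<noteq> 0"
  by (simp add: zeta_def)

lemma zeta_powi_eq_1_iff: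
  assumes "m > 0"
  shows "zeta m powi k = 1 \<longleftrightarrow> int m dvd k"
proof -
  have z: "zeta m powi k = cis (of_int k * (2 * pi / real m))"
    by (simp add: zeta_def cis_power_int)
  show ?thesis
  proof
    assume "zeta m powi k = 1"
    then have "cos (of_int k * (2 * pi / real m)) = 1"
      using z by (metis cis.sel(1) one_complex.sel(1))
    then obtain l :: int where "of_int k * (2 * pi / real m) = of_int l * 2 * pi"
      using cos_one_2pi_int by blast
    then have "real_of_int k = real_of_int (l * int m)"
      using assms by (simp add: field_simps)
    then have "k = l * int m" by (simp only: of_int_eq_iff)
    then show "int m dvd k" by simp
  next
    assume "int m dvd k"
    then obtain l where "k = int m * l" by auto
    then have "of_int k * (2 * pi / real m) = 2 * pi * of_int l" using assms by simp
    then show "zeta m powi k = 1" using z cis_multiple_2pi[of "of_int l"] by simp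
  qed
qed

lemma zeta_powi_eq_iff:
  assumes "m > 0"
  shows "zeta m powi k = zeta m powi l \<longleftrightarrow> k mod int m = l mod int m"
proof -
  have "zeta m powi k = zeta m powi l \<longleftrightarrow> zeta m powi (k - l) = 1"
    by (auto simp: power_int_diff)
  then show ?thesis using zeta_powi_eq_1_iff[OF assms] by (simp add: mod_eq_dvd_iff)
qed

lemma monomial_mat_carrier [simp]: "monomial_mat m n u a \<in> carrier_mat n n"
  by (simp add: monomial_mat_def)

lemma monomial_mat_cong:
  assumes "m > 0" "\<And>i. i < n \<Longrightarrow> a i mod int m = b i mod int m"
  shows "monomial_mat m n u a = monomial_mat m n u b"
  unfolding monomial_mat_def by (rule cong_mat) (use assms zeta_powi_eq_iff in auto)

lemma monomial_mat_eqD: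
  assumes "m > 0" "u permutes {..<n}" "v permutes {..<n}"
    and eq: "monomial_mat m n u a = monomial_mat m n v b"
  shows "u = v" and "i < n \<Longrightarrow> a i mod int m = b i mod int m"
proof -
  have *: "u i = v i \<and> a i mod int m = b i mod int m" if "i < n" for i
  proof -
    have "u i < n" using assms(2) that permutes_in_image by fastforce
    then have "(if u i = v i then zeta m powi b i else 0) = zeta m powi a i"
      using arg_cong[OF eq, of "\<lambda>A. A $$ (u i, i)"] that by (simp add: monomial_mat_def)
    then have "u i = v i" "zeta m powi b i = zeta m powi a i"
      using power_int_eq_0_iff zeta_nonzero by (metis)+
    then show ?thesis using zeta_powi_eq_iff[OF assms(1)] by metis
  qed
  then show "i < n \<Longrightarrow> a i mod int m = b i mod int m" by blast
  show "u = v"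
  proof
    fix i show "u i = v i"
      using * assms(2,3) by (cases "i < n") (auto simp: permutes_def)
  qed
qed

lemma monomial_mat_mult:
  assumes "v permutes {..<n}"
  shows "monomial_mat m n u a * monomial_mat m n v b = monomial_mat m n (u \<circ> v) (\<lambda>i. b i + a (v i))"
proof (rule eq_matI)
  fix r c assume "r < dim_row (monomial_mat m n (u \<circ> v) (\<lambda>i. b i + a (v i)))"
    "c < dim_col (monomial_mat m n (u \<circ> v) (\<lambda>i. b i + a (v i)))"
  then have rc: "r < n" "c < n" by (auto simp: monomial_mat_def)
  then have v: "v c < n" using assms permutes_in_image by fastforce
  have "(monomial_mat m n u a * monomial_mat m n v b) $$ (r, c)
      = (\<Sum>k<n. (if r = u k then zeta m powi a k else 0) * (if k = v c then zeta m powi b c else 0))"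
    using rc by (simp add: monomial_mat_def scalar_prod_def lessThan_atLeast0)
  also have "\<dots> = (\<Sum>k<n. if k = v c then (if r = u k then zeta m powi a k else 0) * zeta m powi b c else 0)"
    by (intro sum.cong) auto
  also have "\<dots> = (if r = u (v c) then zeta m powi (b c + a (v c)) else 0)"
    using v by (simp add: power_int_add)
  finally show "(monomial_mat m n u a * monomial_mat m n v b) $$ (r, c) =
      monomial_mat m n (u \<circ> v) (\<lambda>i. b i + a (v i)) $$ (r, c)"
    using rc by (simp add: monomial_mat_def)
qed (simp_all add: monomial_mat_def)

lemma monomial_mat_one: "monomial_mat m n id (\<lambda>_. 0) = 1\<^sub>m n"
  by (rule eq_matI) (auto simp: monomial_mat_def)

section \<open>Fixed vectors, cycle by cycle\<close>

lemma mult_monomial_mat_vec: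
  assumes "u permutes {..<n}" "v \<in> carrier_vec n" "c < n"
  shows "(monomial_mat m n u a *\<^sub>v v) $ (u c) = zeta m powi a c * v $ c"
proof -
  have "u c < n" using assms(1,3) permutes_in_image by fastforce
  then have "(monomial_mat m n u a *\<^sub>v v) $ (u c) = (\<Sum>k<n. (if u c = u k then zeta m powi a k else 0) * v $ k)"
    using assms(2) by (simp add: monomial_mat_def scalar_prod_def lessThan_atLeast0)
  also have "\<dots> = (\<Sum>k<n. if k = c then zeta m powi a k * v $ k else 0)"
    using permutes_inj[OF assms(1)] by (intro sum.cong) (auto dest: injD)
  finally show ?thesis using assms(3) by simp
qed

lemma fix_iff:
  assumes u: "u permutes {..<n}" and v: "v \<in> carrier_vec n"
  shows "v \<in> mat_kernel (monomial_mat m n u a - 1\<^sub>m n) \<longleftrightarrow> (\<forall>c<n. v $ (u c) = zeta m powi a c * v $ c)"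
proof -
  let ?w = "monomial_mat m n u a"
  have wv: "?w *\<^sub>v v \<in> carrier_vec n" using v mult_mat_vec_carrier[OF monomial_mat_carrier] by blast
  have u': "u c < n" if "c < n" for c using u that permutes_in_image by fastforce
  have A: "?w - 1\<^sub>m n \<in> carrier_mat n n" by (intro minus_carrier_mat) simp
  have "(?w - 1\<^sub>m n) *\<^sub>v v = ?w *\<^sub>v v - v"
    using v by (simp add: minus_mult_distrib_mat_vec[OF monomial_mat_carrier])
  then have "v \<in> mat_kernel (?w - 1\<^sub>m n) \<longleftrightarrow> ?w *\<^sub>v v - v = 0\<^sub>v n"
    using v by (simp add: mat_kernel[OF A])
  also have "\<dots> \<longleftrightarrow> (\<forall>r<n. (?w *\<^sub>v v) $ r = v $ r)"
    using v wv by (auto simp: vec_eq_iff)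
  also have "\<dots> \<longleftrightarrow> (\<forall>c<n. (?w *\<^sub>v v) $ (u c) = v $ (u c))"
    using u' permutes_surj[OF u] permutes_in_image[OF u] by (metis lessThan_iff surjD)
  also have "\<dots> \<longleftrightarrow> (\<forall>c<n. v $ (u c) = zeta m powi a c * v $ c)"
    using mult_monomial_mat_vec[OF u v] by metis
  finally show ?thesis .
qed

lemma fix_funpow:
  assumes u: "u permutes {..<n}" and v: "v \<in> carrier_vec n" "v \<in> mat_kernel (monomial_mat m n u a - 1\<^sub>m n)"
    and i: "i < n"
  shows "v $ ((u ^^ k) i) = zeta m powi (\<Sum>j<k. a ((u ^^ j) i)) * v $ i"
proof (induction k)
  case (Suc k)
  have "(u ^^ k) i < n" using cyc_bound[OF u i] funpow_in_cyc by blast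
  then show ?case using Suc fix_iff[OF u v(1)] v(2) by (simp add: power_int_add ac_simps)
qed simp

lemma cyc_enum:
  assumes u: "u permutes {..<n}"
  obtains L where "L > 0" "(u ^^ L) i = i" "bij_betw (\<lambda>k. (u ^^ k) i) {..<L} (cyc u i)"
proof -
  have p: "permutation u" using permutes_imp_permutation[OF _ u] by simp
  let ?L = "least_power u i"
  have "bij_betw (\<lambda>k. (u ^^ k) i) {..<?L} (cyc u i)"
  proof -
    have "distinct (support u i)" by (rule cycle_of_permutation[OF p])
    then have "inj_on (\<lambda>k. (u ^^ k) i) {..<?L}"
      by (simp add: distinct_map lessThan_atLeast0)
    moreover have "(\<lambda>k. (u ^^ k) i) ` {..<?L} = cyc u i"
      using support_set[OF p, of i] by (auto simp: cyc_def lessThan_atLeast0)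
    ultimately show ?thesis by (simp add: bij_betw_def)
  qed
  then show thesis using that least_power_of_permutation[OF p] by blast
qed

text \<open>Starting from the value 1 at \<open>i\<close>, the coordinates of a fixed vector along
  the cycle are forced to be powers of \<open>zeta m\<close> with the partial sums
  \<open>f k\<close> as exponents. The rule closes up after \<open>L\<close> steps because
  \<open>f L\<close> is the weight of the cycle, which is null.\<close>

lemma fix_null_cycle:
  assumes m: "m > 0" and u: "u permutes {..<n}" and C: "C \<in> cycles_of n u" "int m dvd wt a C"
  obtains v where "v \<in> carrier_vec n" "v \<in> mat_kernel (monomial_mat m n u a - 1\<^sub>m n)"
    "\<And>x. x < n \<Longrightarrow> v $ x \<noteq> 0 \<longleftrightarrow> x \<in> C"
proof -
  obtain i where i: "i < n" "C = cyc u i" using C by (auto simp: cycles_of_eq)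
  obtain L where L: "L > 0" "(u ^^ L) i = i" "bij_betw (\<lambda>k. (u ^^ k) i) {..<L} C"
    using cyc_enum[OF u, of i] i by metis
  define f where "f k = (\<Sum>j<k. a ((u ^^ j) i))" for k
  define g where "g = inv_into {..<L} (\<lambda>k. (u ^^ k) i)"
  have g: "g ((u ^^ k) i) = k" if "k < L" for k
    using bij_betw_inv_into_left[OF L(3), of k] that by (simp add: g_def)
  have fL: "f L = wt a C"
    unfolding f_def wt_def using L(3) by (rule sum.reindex_bij_betw)
  define v where "v = vec n (\<lambda>x. if x \<in> C then zeta m powi f (g x) else 0)"
  have v: "v \<in> carrier_vec n" by (simp add: v_def)
  have "v $ (u x) = zeta m powi a x * v $ x" if x: "x < n" for x
  proof (cases "x \<in> C")
    case True
    then obtain k where k: "k < L" "x = (u ^^ k) i" using L(3) by (auto simp: bij_betw_def)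
    have "u x \<in> C" using True i cyc_step by blast
    moreover have ux: "u x < n" using u x permutes_in_image by fastforce
    moreover have "zeta m powi f (g (u x)) = zeta m powi (f (Suc k))"
    proof (cases "Suc k < L")
      case True
      then show ?thesis using g[OF True] k by simp
    next
      case False
      then have "Suc k = L" using k by simp
      moreover from this have "u x = (u ^^ 0) i" using L(2) k by auto
      then have "f (g (u x)) = 0" using g[OF L(1)] by (simp add: f_def)
      ultimately show ?thesis
        using C(2) fL by (simp add: zeta_powi_eq_1_iff[OF m])
    qed
    moreover have "f (Suc k) = f (g x) + a x" using g[OF k(1)] k by (simp add: f_def)
    ultimately show ?thesis using True x by (simp add: v_def power_int_add)
  next
    case False
    moreover have "u x \<notin> C"
    proof
      assume "u x \<in> C"
      then have "cyc u x = C" using cyc_eq[OF u cyc_step[OF cyc_self]] cycles_of_memD[OF u C(1)] by metis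
      then show False using False cyc_self by blast
    qed
    moreover have "u x < n" using u x permutes_in_image by fastforce
    ultimately show ?thesis using x by (simp add: v_def)
  qed
  then have "v \<in> mat_kernel (monomial_mat m n u a - 1\<^sub>m n)" using fix_iff[OF u v] by simp
  moreover have "v $ x \<noteq> 0 \<longleftrightarrow> x \<in> C" if "x < n" for x
    using that by (simp add: v_def)
  ultimately show thesis using that v by blast
qed

text \<open>Going once round the cycle multiplies the coordinate by \<open>zeta m\<close> raised to
  the weight of the cycle, a factor other than 1.\<close>

lemma fix_nonnull_cycle:
  assumes m: "m > 0" and u: "u permutes {..<n}" and v: "v \<in> carrier_vec n" "v \<in> mat_kernel (monomial_mat m n u a - 1\<^sub>m n)"
    and i: "i < n" "\<not> int m dvd wt a (cyc u i)"
  shows "v $ i = 0"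
proof -
  obtain L where L: "L > 0" "(u ^^ L) i = i" "bij_betw (\<lambda>k. (u ^^ k) i) {..<L} (cyc u i)"
    using cyc_enum[OF u, of i] by metis
  have "(\<Sum>j<L. a ((u ^^ j) i)) = wt a (cyc u i)"
    unfolding wt_def using L(3) by (rule sum.reindex_bij_betw)
  then have "v $ i = zeta m powi (wt a (cyc u i)) * v $ i"
    using fix_funpow[OF u v i(1), of L] L(2) by simp
  then show ?thesis using zeta_powi_eq_1_iff[OF m] i(2) by auto
qed

text \<open>The vectors of the null cycles form a basis. Their supports are disjoint, so each
  coordinate of a linear combination sees at most one of them. A fixed vector vanishes off the null
  cycles and is determined on each of them by a single coordinate.\<close>

lemma kernel_dim_monomial_mat:
  assumes m: "m > 0" and u: "u permutes {..<n}"
  shows "kernel_dim (monomial_mat m n u a - 1\<^sub>m n) = card {C \<in> cycles_of n u. int m dvd wt a C}"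
proof -
  define A where "A = monomial_mat m n u a - 1\<^sub>m n"
  define Z where "Z = {C \<in> cycles_of n u. int m dvd wt a C}"
  have Zc: "C \<in> cycles_of n u" if "C \<in> Z" for C using that by (simp add: Z_def)
  have finZ: "finite Z" by (simp add: Z_def)
  interpret kernel n n A by unfold_locales (unfold A_def, intro minus_carrier_mat, simp)
  have "\<forall>C\<in>Z. \<exists>v. v \<in> carrier_vec n \<and> v \<in> mat_kernel A \<and> (\<forall>x<n. v $ x \<noteq> 0 \<longleftrightarrow> x \<in> C)"
  proof
    fix C assume "C \<in> Z"
    then have "C \<in> cycles_of n u" "int m dvd wt a C" by (auto simp: Z_def)
    from fix_null_cycle[OF m u this] show "\<exists>v. v \<in> carrier_vec n \<and> v \<in> mat_kernel A \<and> (\<forall>x<n. v $ x \<noteq> 0 \<longleftrightarrow> x \<in> C)"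
      unfolding A_def by metis
  qed
  then obtain b where b: "\<And>C. C \<in> Z \<Longrightarrow> b C \<in> carrier_vec n" "\<And>C. C \<in> Z \<Longrightarrow> b C \<in> mat_kernel A"
    "\<And>C x. C \<in> Z \<Longrightarrow> x < n \<Longrightarrow> b C $ x \<noteq> 0 \<longleftrightarrow> x \<in> C"
    by metis
  have sub: "C \<subseteq> {..<n}" "C \<noteq> {}" if "C \<in> Z" for C
    using cycles_of_bound[OF u] Zc[OF that] partition_onD3[OF partition_on_cycles_of[OF u]] by auto
  have inj: "inj_on b Z"
  proof (rule inj_onI)
    fix C C' assume C: "C \<in> Z" "C' \<in> Z" "b C = b C'"
    then have "x \<in> C \<longleftrightarrow> x \<in> C'" if "x < n" for x using b(3)[OF C(1) that] b(3)[OF C(2) that] by simp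
    then show "C = C'" using sub(1)[OF C(1)] sub(1)[OF C(2)] by blast
  qed
  let ?B = "b ` Z"
  have finB: "finite ?B" using finZ by simp
  have Bk: "?B \<subseteq> mat_kernel A" using b(2) by auto
  have Bc: "?B \<subseteq> carrier_vec n" using b(1) by auto
  have lin: "lincomb c ?B $ x = (if cyc u x \<in> Z then c (b (cyc u x)) * b (cyc u x) $ x else 0)" if x: "x < n" for c x
  proof -
    have "lincomb c ?B $ x = (\<Sum>v\<in>?B. c v * v $ x)"
      by (rule lincomb_index[OF x Bk])
    also have "\<dots> = (\<Sum>C\<in>Z. c (b C) * b C $ x)" by (simp add: sum.reindex[OF inj])
    also have "\<dots> = (\<Sum>C\<in>Z. if C = cyc u x then c (b C) * b C $ x else 0)"
    proof (rule sum.cong)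
      fix C assume C: "C \<in> Z"
      have "b C $ x = 0" if "C \<noteq> cyc u x"
        using that b(3)[OF C x] cycles_of_memD[OF u Zc[OF C]] by blast
      then show "c (b C) * b C $ x = (if C = cyc u x then c (b C) * b C $ x else 0)" by simp
    qed simp
    finally show ?thesis using finZ by simp
  qed
  have lcdim: "lincomb c ?B \<in> carrier_vec n" for c
    using Ker.lincomb_closed[of ?B c] Bk mat_kernel_carrier[OF A] by auto
  have "lin_indpt ?B"
  proof (rule Ker.finite_lin_indpt2[OF finB])
    fix c assume c: "lincomb c ?B = 0\<^sub>v n"
    show "\<forall>v\<in>?B. c v = 0"
    proof
      fix v assume "v \<in> ?B"
      then obtain C where C: "C \<in> Z" "v = b C" by auto
      then obtain x where x: "x \<in> C" "x < n" using sub[OF C(1)] by auto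
      have "cyc u x = C" using cycles_of_memD[OF u Zc[OF C(1)] x(1)] by simp
      then have "c v * v $ x = 0" using lin[OF x(2), of c] c C x by simp
      then show "c v = 0" using b(3)[OF C(1) x(2)] C x by simp
    qed
  qed (use Bk in auto)
  moreover have "span ?B = mat_kernel A"
  proof -
    have sp: "v \<in> span ?B" if v: "v \<in> mat_kernel A" for v
    proof -
      have vc: "v \<in> carrier_vec n" using v mat_kernel_carrier[OF A] by auto
      \<comment> \<open>One base point per null cycle: the coefficient of a basis vector is the
        ratio of the coordinates there, and \<open>fix_funpow\<close> carries the agreement round
        the cycle.\<close>
      define s where "s C = (SOME x. x \<in> C)" for C :: "nat set"
      have s: "s C \<in> C" "s C < n" if "C \<in> Z" for C
        using sub[OF that] unfolding s_def by (auto intro: some_in_eq[THEN iffD2] dest: some_in_eq[THEN iffD2])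
      define c where "c w = (let C = inv_into Z b w in v $ s C / w $ s C)" for w
      have cb: "c (b C) = v $ s C / b C $ s C" if "C \<in> Z" for C
        using inv_into_f_f[OF inj that] by (simp add: c_def)
      have "v = lincomb c ?B"
      proof (rule eq_vecI)
        show "dim_vec v = dim_vec (lincomb c ?B)" using vc lcdim[of c] by simp
        fix x assume "x < dim_vec (lincomb c ?B)"
        then have x: "x < n" using lcdim[of c] by simp
        show "v $ x = lincomb c ?B $ x"
        proof (cases "cyc u x \<in> Z")
          case False
          then have "\<not> int m dvd wt a (cyc u x)" using x by (auto simp: Z_def cycles_of_eq)
          then show ?thesis using False lin[OF x] fix_nonnull_cycle[OF m u vc v[unfolded A_def] x] by simp
        next
          case True
          let ?C = "cyc u x"
          have "s ?C \<in> ?C" "s ?C < n" using s[OF True] by auto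
          then obtain k where k: "x = (u ^^ k) (s ?C)"
            using cyc_sym[OF u \<open>s ?C \<in> ?C\<close>] by (auto simp: cyc_def)
          have nz: "b ?C $ s ?C \<noteq> 0" using b(3)[OF True \<open>s ?C < n\<close>] \<open>s ?C \<in> ?C\<close> by simp
          let ?e = "zeta m powi (\<Sum>j<k. a ((u ^^ j) (s ?C)))"
          have "v $ x = ?e * v $ s ?C"
            using fix_funpow[OF u vc v[unfolded A_def] \<open>s ?C < n\<close>, of k] k by simp
          moreover have "b ?C $ x = ?e * b ?C $ s ?C"
            using fix_funpow[OF u b(1)[OF True] b(2)[OF True, unfolded A_def] \<open>s ?C < n\<close>, of k] k by simp
          ultimately show ?thesis using lin[OF x, of c] True cb[OF True] nz by simp
        qed
      qed
      then show ?thesis unfolding Ker.span_def using finB by blast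
    qed
    have "span ?B \<subseteq> mat_kernel A" using Ker.span_is_subset2[OF Bk] by simp
    then show ?thesis by (rule subset_antisym[OF _ subsetI[OF sp]])
  qed
  ultimately have "basis ?B" using Bk by (simp add: Ker.basis_def)
  then have "dim = card ?B" by (rule Ker.dim_basis[OF finB])
  then show ?thesis using kernel_dim card_image[OF inj] by (simp add: A_def Z_def)
qed

lemma zeros_image_mset_mod:
  assumes "finite S"
  shows "zeros (int m) (image_mset (\<lambda>C. f C mod int m) (mset_set S)) = card {C \<in> S. int m dvd f C}"
  using assms by (simp add: zeros_def filter_mset_image_mset dvd_mod_iff filter_mset_mset_set)

lemma codimfix_monomial_mat:
  assumes "m > 0" "u permutes {..<n}"
  shows "codimfix n (monomial_mat m n u a) = n - zeros (int m) (cycle_weights m n u a)"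
  using assms by (simp add: codimfix_def kernel_dim_monomial_mat cycle_weights_def zeros_image_mset_mod)

lemma zeros_le_size: "zeros m M \<le> size M"
  by (simp add: zeros_def size_filter_mset_lesseq)

text \<open>Serves to exchange the factors of a product: \<open>x * y\<close> is also
  \<open>y\<close> times a conjugate of \<open>x\<close>.\<close>

lemma codimfix_similar:
  fixes x :: "complex mat"
  assumes c: "x \<in> carrier_mat n n" "P \<in> carrier_mat n n" "Q \<in> carrier_mat n n"
    and PQ: "P * Q = 1\<^sub>m n" "Q * P = 1\<^sub>m n"
  shows "codimfix n (P * x * Q) = codimfix n x"
proof -
  have A: "P * x * Q - 1\<^sub>m n \<in> carrier_mat n n" "x - 1\<^sub>m n \<in> carrier_mat n n"
    by (intro minus_carrier_mat one_carrier_mat)+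
  have "P * (x - 1\<^sub>m n) = P * x - P"
    using mult_minus_distrib_mat[OF c(2,1) one_carrier_mat] c by simp
  then have "P * (x - 1\<^sub>m n) * Q = P * x * Q - P * Q"
    using minus_mult_distrib_mat[of "P * x" n n P Q n] c by simp
  then have eq: "P * x * Q - 1\<^sub>m n = P * (x - 1\<^sub>m n) * Q" using PQ by simp
  have "similar_mat_wit (P * x * Q - 1\<^sub>m n) (x - 1\<^sub>m n) P Q"
    by (rule similar_mat_witI[OF PQ eq]) (use A c in auto)
  from similar_mat_wit_kernel_dim[OF A(1) this]
  have "kernel.dim n (P * x * Q - 1\<^sub>m n) = kernel.dim n (x - 1\<^sub>m n)" .
  then have "kernel_dim (P * x * Q - 1\<^sub>m n) = kernel_dim (x - 1\<^sub>m n)"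
    using A by (simp add: kernel_dim_def)
  then show ?thesis by (simp add: codimfix_def)
qed

section \<open>Reflections\<close>

text \<open>The matrix determines the exponents only modulo \<open>m\<close>; the choice is harmless because cycle
  weights are reduced modulo \<open>m\<close>.\<close>
definition weights :: "nat \<Rightarrow> nat \<Rightarrow> complex mat \<Rightarrow> int multiset" where
  "weights m n w = (SOME M. \<exists>u a. u permutes {..<n} \<and> w = monomial_mat m n u a \<and> M = cycle_weights m n u a)"

lemma weights_monomial_mat:
  assumes "m > 0" "u permutes {..<n}"
  shows "weights m n (monomial_mat m n u a) = cycle_weights m n u a"
  unfolding weights_def
proof (rule some_equality)
  fix M assume "\<exists>v b. v permutes {..<n} \<and> monomial_mat m n u a = monomial_mat m n v b \<and> M = cycle_weights m n v b"
  then obtain v b where vb: "v permutes {..<n}" "monomial_mat m n u a = monomial_mat m n v b" "M = cycle_weights m n v b"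
    by auto
  have "u = v" "\<And>i. i < n \<Longrightarrow> a i mod int m = b i mod int m"
    using monomial_mat_eqD[OF assms vb(1,2)] by auto
  then show "M = cycle_weights m n u a" using cycle_weights_cong[OF assms(2)] vb(3) by metis
qed (use assms in blast)

lemma cycles_of_id: "cycles_of n id = (\<lambda>i. {i}) ` {..<n}"
  by (auto simp: cycles_of_eq cyc_def)

lemma image_mset_mset_set_addE:
  assumes "image_mset f (mset_set S) = M + {#x#}" "finite S"
  obtains C where "C \<in> S" "f C = x" "M = image_mset f (mset_set (S - {C}))"
proof -
  have "x \<in># image_mset f (mset_set S)" using assms(1) by simp
  then obtain C where C: "C \<in> S" "f C = x" using assms(2) by auto
  then have "mset_set S = add_mset C (mset_set (S - {C}))"
    using assms(2) by (simp add: mset_set.remove)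
  then have "M = image_mset f (mset_set (S - {C}))" using assms(1) C by simp
  then show thesis using that C by blast
qed

locale gmpn =
  fixes m p n :: nat
  assumes m: "m > 0" and pm: "p dvd m"
begin

abbreviation "mm \<equiv> monomial_mat m n"
abbreviation "G \<equiv> Gmpn m p n"
abbreviation "R \<equiv> reflections m p n"
abbreviation "W \<equiv> weights m n"

lemma ipm: "int p dvd int m" using pm by simp

lemma G_I: "u permutes {..<n} \<Longrightarrow> int p dvd wt a {..<n} \<Longrightarrow> mm u a \<in> G"
  by (auto simp: Gmpn_def)

lemma G_E:
  assumes "w \<in> G"
  obtains u a where "u permutes {..<n}" "int p dvd wt a {..<n}" "w = mm u a" "W w = cycle_weights m n u a"
  using assms weights_monomial_mat[OF m] by (auto simp: Gmpn_def)

lemma G_carrier: "w \<in> G \<Longrightarrow> w \<in> carrier_mat n n"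
  by (auto elim: G_E)

lemma wt_mult:
  assumes "v permutes {..<n}"
  shows "wt (\<lambda>i. b i + a (v i)) {..<n} = wt b {..<n} + wt a {..<n}"
  using sum.permute[OF assms, of a] by (simp add: wt_def sum.distrib o_def)

lemma G_mult: "x \<in> G \<Longrightarrow> y \<in> G \<Longrightarrow> x * y \<in> G"
proof (elim G_E)
  fix u a v b assume *: "u permutes {..<n}" "int p dvd wt a {..<n}" "x = mm u a"
    "v permutes {..<n}" "int p dvd wt b {..<n}" "y = mm v b"
  then have "x * y = mm (u \<circ> v) (\<lambda>i. b i + a (v i))" by (simp add: monomial_mat_mult)
  moreover have "int p dvd wt (\<lambda>i. b i + a (v i)) {..<n}" using * wt_mult by simp
  ultimately show "x * y \<in> G" using * by (auto intro!: G_I permutes_compose)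
qed

lemma G_one: "1\<^sub>m n \<in> G"
  using G_I[of id "\<lambda>_. 0"] by (simp add: monomial_mat_one permutes_id wt_def)

lemma G_inv:
  assumes "x \<in> G"
  obtains y where "y \<in> G" "y * x = 1\<^sub>m n" "x * y = 1\<^sub>m n"
proof -
  from assms obtain u a where u: "u permutes {..<n}" "int p dvd wt a {..<n}" "x = mm u a"
    by (rule G_E)
  let ?v = "inv_into UNIV u" and ?b = "\<lambda>i. - a (inv_into UNIV u i)"
  have v: "?v permutes {..<n}" using u by (simp add: permutes_inv)
  have "wt ?b {..<n} = - wt a {..<n}"
    using sum.permute[OF v, of a] by (simp add: wt_def sum_negf o_def)
  then have G: "mm ?v ?b \<in> G" using v u by (intro G_I) simp_all
  have "mm ?v ?b * x = mm id (\<lambda>_. 0)"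
    using monomial_mat_mult[OF u(1), of m ?v ?b a] u permutes_inv_o[OF u(1)] permutes_inverses[OF u(1)] by simp
  moreover have "x * mm ?v ?b = mm id (\<lambda>_. 0)"
    using monomial_mat_mult[OF v, of m u a ?b] u permutes_inv_o[OF u(1)] by simp
  ultimately show thesis using that G by (simp add: monomial_mat_one)
qed

lemma ginv_mult:
  assumes "x \<in> G" "y \<in> G"
  shows "ginv m p n x * (x * y) = y"
proof -
  obtain z where z: "z \<in> G" "z * x = 1\<^sub>m n" "x * z = 1\<^sub>m n" using G_inv[OF assms(1)] .
  have "ginv m p n x = z"
    unfolding ginv_def
  proof (rule the_equality)
    fix z' assume z': "z' \<in> G \<and> z' * x = 1\<^sub>m n"
    then have "z' = z' * (x * z)" using z G_carrier[of z'] by simp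
    also have "\<dots> = z' * x * z" using z z' assms G_carrier by (metis assoc_mult_mat)
    also have "\<dots> = z" using z' z G_carrier[of z] by simp
    finally show "z' = z" .
  qed (use z in simp)
  moreover have "z * (x * y) = z * x * y" using z assms G_carrier by (metis assoc_mult_mat)
  ultimately show ?thesis using z G_carrier[OF assms(2)] by simp
qed

lemma le_f_mult_iff:
  "x \<in> G \<Longrightarrow> y \<in> G \<Longrightarrow> le_f m p n f x (x * y) \<longleftrightarrow> f x + f y = f (x * y)"
  by (simp add: le_f_def ginv_mult)

lemma G_divideE:
  assumes "x \<in> G" "w \<in> G"
  obtains y where "y \<in> G" "w = x * y"
proof -
  obtain z where z: "z \<in> G" "z * x = 1\<^sub>m n" "x * z = 1\<^sub>m n" using G_inv[OF assms(1)] .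
  have "x * (z * w) = x * z * w" using z assms G_carrier by (metis assoc_mult_mat)
  then have "w = x * (z * w)" using z G_carrier[OF assms(2)] by simp
  then show thesis using that G_mult[OF z(1) assms(2)] by blast
qed

lemma codimfix_weights:
  assumes "w \<in> G"
  shows "codimfix n w = n - zeros (int m) (W w)" "zeros (int m) (W w) \<le> n"
    "int (codimfix n w) = int n - int (zeros (int m) (W w))"
proof -
  from assms obtain u a where u: "u permutes {..<n}" "w = mm u a" "W w = cycle_weights m n u a" by (rule G_E)
  then show 1: "codimfix n w = n - zeros (int m) (W w)"
    using codimfix_monomial_mat[OF m u(1), of a] by simp
  show 2: "zeros (int m) (W w) \<le> n"
    using zeros_le_size[of "int m" "W w"] card_cycles_of_le[of n u] size_cycle_weights[of m n u a] u by simp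
  show "int (codimfix n w) = int n - int (zeros (int m) (W w))" using 1 2 by simp
qed

lemma weights_range: "w \<in> G \<Longrightarrow> x \<in># W w \<Longrightarrow> 0 \<le> x \<and> x < int m"
  using m by (elim G_E) (auto simp: cycle_weights_def)

lemma dvd_sum_weights: "w \<in> G \<Longrightarrow> int p dvd \<Sum>\<^sub># (W w)"
  by (elim G_E) (use pm in \<open>simp add: dvd_sum_cycle_weights\<close>)

lemma weights_one: "W (1\<^sub>m n) = replicate_mset n 0"
proof -
  have "W (1\<^sub>m n) = cycle_weights m n id (\<lambda>_. 0)"
    using weights_monomial_mat[OF m permutes_id, of n "\<lambda>_. 0"] by (simp add: monomial_mat_one)
  also have "\<dots> = replicate_mset n 0"
    using card_cycles_of_eq_iff[OF permutes_id, of n]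
    by (simp add: cycle_weights_def wt_def image_mset_const_eq)
  finally show ?thesis .
qed

lemma zeros_replicate: "zeros (int m) (replicate_mset k 0) = k"
  by (induction k) auto

section \<open>The two families of reflections\<close>

lemma mult_swap:
  assumes "u permutes {..<n}" "i < n" "j < n"
  shows "mm u a * mm (transpose i j) (swap_wt i j k) =
    mm (u \<circ> transpose i j) (\<lambda>c. swap_wt i j k c + a (transpose i j c))"
  using assms by (intro monomial_mat_mult permutes_swap_id) auto

lemma mult_unit: "mm u a * mm id (unit_wt i k) = mm u (\<lambda>c. unit_wt i k c + a c)"
  using monomial_mat_mult[OF permutes_id, of m n u a "unit_wt i k"] by simp

lemma swap_swap:
  assumes "i < n" "j < n" "i \<noteq> j"
  shows "mm (transpose i j) (swap_wt i j k) * mm (transpose i j) (swap_wt i j k) = 1\<^sub>m n"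
proof -
  have "(\<lambda>c. swap_wt i j k c + swap_wt i j k (transpose i j c)) = (\<lambda>_. 0)"
    using assms by (auto simp: swap_wt_def transpose_def fun_eq_iff)
  moreover have "transpose i j permutes {..<n}" using assms by (intro permutes_swap_id) auto
  ultimately show ?thesis
    using mult_swap[of "transpose i j" i j "swap_wt i j k" k] assms by (simp add: monomial_mat_one o_def id_def[symmetric])
qed

lemma swap_in_G:
  assumes "i < n" "j < n" "i \<noteq> j"
  shows "mm (transpose i j) (swap_wt i j k) \<in> G"
proof (rule G_I)
  show "transpose i j permutes {..<n}" using assms by (intro permutes_swap_id) auto
  have "wt (swap_wt i j k) {..<n} = 0"
    using wt_swap[of "{..<n}" i j k "\<lambda>_. 0"] assms by (simp add: wt_def)
  then show "int p dvd wt (swap_wt i j k) {..<n}" by simp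
qed

lemma unit_in_G:
  assumes "i < n" "int p dvd k"
  shows "mm id (unit_wt i k) \<in> G"
proof (rule G_I)
  show "int p dvd wt (unit_wt i k) {..<n}"
    using assms wt_unit[of "{..<n}" i k "\<lambda>_. 0"] by (simp add: wt_def)
qed (simp add: permutes_id)

text \<open>Multiplying the identity by this matrix merges two of its \<open>n\<close> null weights
  into one null weight, so \<open>n - 1\<close> remain.\<close>

lemma swap_reflection:
  assumes "i < n" "j < n" "i \<noteq> j"
  shows "mm (transpose i j) (swap_wt i j k) \<in> R"
proof -
  let ?r = "mm (transpose i j) (swap_wt i j k)"
  have G: "?r \<in> G" using swap_in_G[OF assms] .
  have c: "{i} \<in> cycles_of n id" "{j} \<in> cycles_of n id" "{i} \<noteq> {j}" "i \<in> {i}" "j \<in> {j}"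
    using assms by (auto simp: cycles_of_id)
  note M = cycle_weights_merge[OF permutes_id c, where m = m and a = "\<lambda>_. 0"]
  have "W ?r = cycle_weights m n (transpose i j) (swap_wt i j k)"
    using assms by (intro weights_monomial_mat[OF m] permutes_swap_id) auto
  then have "Suc (zeros (int m) (W ?r)) = zeros (int m) (cycle_weights m n id (\<lambda>_. 0))"
    using M(1) M(2)[where k = k] by (simp add: wt_def)
  also have "\<dots> = n"
    using weights_one weights_monomial_mat[OF m permutes_id, of n "\<lambda>_. 0"] zeros_replicate[of n]
    by (metis monomial_mat_one)
  finally show ?thesis using G codimfix_weights[OF G] by (simp add: reflections_def)
qed

lemma unit_reflection:
  assumes "i < n" "int p dvd k" "\<not> int m dvd k"
  shows "mm id (unit_wt i k) \<in> R"
proof -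
  let ?r = "mm id (unit_wt i k)"
  have G: "?r \<in> G" using unit_in_G[OF assms(1,2)] .
  have c: "{i} \<in> cycles_of n id" "i \<in> {i}"
    using assms by (auto simp: cycles_of_id)
  note M = cycle_weights_shift[OF permutes_id c, where m = m and a = "\<lambda>_. 0"]
  have "W ?r = cycle_weights m n id (unit_wt i k)"
    by (intro weights_monomial_mat[OF m] permutes_id) 
  then have "Suc (zeros (int m) (W ?r)) = zeros (int m) (cycle_weights m n id (\<lambda>_. 0))"
    using M(1) M(2)[where k = k] assms(3) by (simp add: wt_def dvd_mod_iff)
  also have "\<dots> = n"
    using weights_one weights_monomial_mat[OF m permutes_id, of n "\<lambda>_. 0"] zeros_replicate[of n]
    by (metis monomial_mat_one)
  finally show ?thesis using G codimfix_weights[OF G] by (simp add: reflections_def)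
qed

text \<open>Composing with the transposition of \<open>i\<close> and \<open>u i\<close> turns
  \<open>u i\<close> into a fixed point. The number of cycles is read off the merge leading back
  from \<open>v\<close> to \<open>u\<close>, with all weights 0.\<close>

lemma cycles_of_split_image:
  assumes u: "u permutes {..<n}" and i: "u i \<noteq> i"
  defines "v \<equiv> u \<circ> transpose i (u i)"
  shows "i < n" "u i < n" "v permutes {..<n}" "{u i} \<in> cycles_of n v" "cyc v i \<in> cycles_of n v"
    "cyc v i \<noteq> {u i}" "u = v \<circ> transpose i (u i)" "card (cycles_of n v) = Suc (card (cycles_of n u))"
proof -
  show n: "i < n" using u i by (metis lessThan_iff permutes_not_in)
  then show n': "u i < n" using u permutes_in_image by fastforce
  show v: "v permutes {..<n}" unfolding v_def using u n n' by (rule transpose_permutes)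
  have "v (u i) = u i" by (simp add: v_def)
  then have "(v ^^ k) (u i) = u i" for k by (induction k) auto
  then have c: "cyc v (u i) = {u i}" by (auto simp: cyc_def)
  then show 1: "{u i} \<in> cycles_of n v" using n' by (force simp: cycles_of_eq)
  show 2: "cyc v i \<in> cycles_of n v" using n by (simp add: cycles_of_eq)
  show 3: "cyc v i \<noteq> {u i}" using cyc_self[of i v] i by (metis singletonD)
  show 4: "u = v \<circ> transpose i (u i)" by (simp add: v_def comp_assoc)
  have "size (cycle_weights m n v (\<lambda>_. 0)) = Suc (size (cycle_weights m n (v \<circ> transpose i (u i))
     (\<lambda>c. swap_wt i (u i) 0 c + 0)))"
    using cycle_weights_merge(1)[OF v 2 1 3 cyc_self, where j = "u i" and m = m and a = "\<lambda>_. 0"]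
      cycle_weights_merge(2)[OF v 2 1 3 cyc_self, where j = "u i" and m = m and a = "\<lambda>_. 0" and k = 0] by simp
  then show "card (cycles_of n v) = Suc (card (cycles_of n u))"
    unfolding size_cycle_weights 4[symmetric] .
qed

text \<open>Codimension 1 means \<open>n - 1\<close> null cycles. If \<open>u\<close> is the
  identity, one diagonal entry differs from 1, and divisibility of the total weight by
  \<open>p\<close> passes to its exponent. Otherwise \<open>u\<close> has at most
  \<open>n - 1\<close> cycles, so it has exactly that many and all are null; then \<open>u\<close>
  is a transposition, and nullity of the cycles fixes the weights modulo \<open>m\<close> up to
  \<open>k\<close>.\<close>

lemma reflection_cases:
  assumes "r \<in> R"
  obtains (unit) i k where "i < n" "int p dvd k" "\<not> int m dvd k" "r = mm id (unit_wt i k)"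
  | (swap) i j k where "i < n" "j < n" "i \<noteq> j" "r = mm (transpose i j) (swap_wt i j k)"
proof -
  have G: "r \<in> G" and cd: "codimfix n r = 1" using assms by (auto simp: reflections_def)
  from G obtain u a where u: "u permutes {..<n}" "int p dvd wt a {..<n}" "r = mm u a" "W r = cycle_weights m n u a"
    by (rule G_E)
  define Z where "Z = {C \<in> cycles_of n u. int m dvd wt a C}"
  have "card Z = zeros (int m) (W r)"
    unfolding u(4) by (simp add: cycle_weights_def zeros_image_mset_mod Z_def)
  then have cz: "Suc (card Z) = n" using cd codimfix_weights[OF G] by simp
  have Zsub: "Z \<subseteq> cycles_of n u" by (auto simp: Z_def)
  show thesis
  proof (cases "u = id")
    case True
    then have "cycles_of n u = (\<lambda>i. {i}) ` {..<n}" by (simp add: cycles_of_id)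
    then have Z: "Z = (\<lambda>i. {i}) ` {i. i < n \<and> int m dvd a i}" by (auto simp: Z_def wt_def)
    then have "card Z = card {i. i < n \<and> int m dvd a i}" by (simp add: card_image)
    moreover have "card {i. i < n \<and> int m dvd a i} + card {i. i < n \<and> \<not> int m dvd a i} = card {..<n}"
      by (subst card_Un_disjoint[symmetric]) (auto intro!: arg_cong[where f = card] simp del: card_lessThan)
    ultimately have "card {i. i < n \<and> \<not> int m dvd a i} = 1" using cz by simp
    then obtain i where i: "{i. i < n \<and> \<not> int m dvd a i} = {i}" by (auto simp: card_1_singleton_iff)
    then have i': "i < n" "\<not> int m dvd a i" by auto
    have a: "int m dvd a c" if "c < n" "c \<noteq> i" for c using i that by auto
    have eq: "a c mod int m = unit_wt i (a i) c mod int m" if "c < n" for c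
      using a[OF that] by (auto simp: unit_wt_def)
    then have "r = mm id (unit_wt i (a i))" using u True monomial_mat_cong[OF m, of n] by metis
    moreover have "int p dvd a i"
    proof -
      have "int p dvd wt a ({..<n} - {i})" unfolding wt_def
        using a dvd_trans[OF ipm] by (intro dvd_sum) auto
      moreover have "wt a {..<n} = a i + wt a ({..<n} - {i})"
        using i' by (simp add: wt_def sum.remove)
      ultimately show ?thesis using u(2) by (simp add: dvd_add_left_iff)
    qed
    ultimately show thesis using unit i' by blast
  next
    case False
    then obtain i where i: "u i \<noteq> i" by fastforce
    note t = cycles_of_split_image[OF u(1) i]
    have "card (cycles_of n u) \<noteq> n" using False card_cycles_of_eq_iff[OF u(1)] by simp
    then have "card (cycles_of n u) \<le> card Z" using cz card_cycles_of_le[of n u] by simp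
    then have "Z = cycles_of n u" using Zsub by (simp add: card_seteq)
    then have null: "int m dvd wt a C" if "C \<in> cycles_of n u" for C using that by (auto simp: Z_def)
    have "card (cycles_of n (u \<circ> transpose i (u i))) = n"
      using t(8) cz \<open>Z = cycles_of n u\<close> by simp
    then have v: "u \<circ> transpose i (u i) = id" using card_cycles_of_eq_iff[OF t(3)] by simp
    define j where "j = u i"
    have ut: "u = transpose i j" using t(7)[unfolded v] unfolding j_def id_o .
    have ij: "i < n" "j < n" "i \<noteq> j" using t(1,2) i by (auto simp: j_def)
    have nj: "j \<notin> cyc id i" using ij by (auto simp: cyc_def)
    have cyc: "cycles_of n u = insert {i, j} (cycles_of n id - {{i}, {j}})"
      using cycles_of_merge[OF permutes_id ij(1,2) nj] ut by (simp add: cyc_def insert_commute)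
    have "int m dvd a i + a j" using null[of "{i, j}"] cyc ij by (simp add: wt_def)
    moreover have "int m dvd a c" if "c < n" "c \<noteq> i" "c \<noteq> j" for c
      using null[of "{c}"] cyc that by (auto simp: cycles_of_id wt_def)
    ultimately have "a c mod int m = swap_wt i j (a i) c mod int m" if "c < n" for c
      using that by (auto simp: swap_wt_def mod_eq_dvd_iff ac_simps)
    then have "r = mm (transpose i j) (swap_wt i j (a i))" using u ut monomial_mat_cong[OF m, of n] by metis
    then show thesis using swap ij by blast
  qed
qed

lemma reflection_in_G: "r \<in> R \<Longrightarrow> r \<in> G"
  by (simp add: reflections_def)

lemma reflection_inv:
  assumes "r \<in> R"
  obtains r' where "r' \<in> R" "r * r' = 1\<^sub>m n"
  using assms
proof (cases rule: reflection_cases)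
  case (unit i k)
  have "(\<lambda>c. unit_wt i (- k) c + unit_wt i k c) = (\<lambda>_. 0)" by (auto simp: unit_wt_def)
  then have "r * mm id (unit_wt i (- k)) = 1\<^sub>m n"
    using unit mult_unit by (simp add: monomial_mat_one)
  moreover have "mm id (unit_wt i (- k)) \<in> R" using unit by (intro unit_reflection) auto
  ultimately show ?thesis using that by blast
next
  case (swap i j k)
  then show ?thesis using that swap_swap swap_reflection by metis
qed

section \<open>Effect of reflections on the cycle weights\<close>

lemma weights_swap:
  fixes k :: int
  assumes "w \<in> G" "i < n" "j < n" "i \<noteq> j"
  defines "w' \<equiv> w * mm (transpose i j) (swap_wt i j k)"
  shows "merges (int m) (W w) (W w') \<or> merges (int m) (W w') (W w)"
proof -
  let ?r = "mm (transpose i j) (swap_wt i j k)"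
  have merge: "merges (int m) (W (mm u a)) (W (mm u a * ?r))" if "u permutes {..<n}" "j \<notin> cyc u i" for u a
  proof -
    have c: "cyc u i \<in> cycles_of n u" "cyc u j \<in> cycles_of n u" "cyc u i \<noteq> cyc u j"
      using assms that cyc_self[of j u] by (auto simp: cycles_of_eq)
    have Wr: "W (mm u a * ?r) = cycle_weights m n (u \<circ> transpose i j) (\<lambda>c. swap_wt i j k c + a (transpose i j c))"
      using mult_swap[OF that(1) assms(2,3)] weights_monomial_mat[OF m transpose_permutes[OF that(1) assms(2,3)]] by simp
    show ?thesis
    proof (rule mergesI)
      show "W (mm u a) = image_mset (\<lambda>C. wt a C mod int m) (mset_set (cycles_of n u - {cyc u i, cyc u j}))
          + {#wt a (cyc u i) mod int m, wt a (cyc u j) mod int m#}"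
        unfolding weights_monomial_mat[OF m that(1)]
        by (rule cycle_weights_merge(1)[OF that(1) c cyc_self cyc_self])
      show "W (mm u a * ?r) = image_mset (\<lambda>C. wt a C mod int m) (mset_set (cycles_of n u - {cyc u i, cyc u j}))
          + {#(wt a (cyc u i) + wt a (cyc u j)) mod int m#}"
        unfolding Wr by (rule cycle_weights_merge(2)[OF that(1) c cyc_self cyc_self])
    qed (simp add: mod_eq_dvd_iff[symmetric] mod_simps)
  qed
  from assms(1) obtain u a where u: "u permutes {..<n}" "w = mm u a" by (rule G_E)
  show ?thesis
  proof (cases "j \<in> cyc u i")
    case False
    then show ?thesis using merge[OF u(1)] u(2) w'_def by simp
  next
    case True
    \<comment> \<open>The split is not computed directly. The reflection is an involution, so
      \<open>w\<close> arises from \<open>w'\<close> by the same multiplication, and this one is a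
      merge by \<open>cyc_split\<close>.\<close>
    let ?v = "u \<circ> transpose i j" and ?b = "\<lambda>c. swap_wt i j k c + a (transpose i j c)"
    have v: "?v permutes {..<n}" using transpose_permutes[OF u(1) assms(2,3)] .
    have w': "w' = mm ?v ?b" using mult_swap[OF u(1) assms(2,3)] u w'_def by simp
    have "w' * ?r = w * (?r * ?r)" unfolding w'_def u(2) by (rule assoc_mult_mat) (rule monomial_mat_carrier)+
    then have "w' * ?r = w" using swap_swap[OF assms(2-4)] right_mult_one_mat[OF monomial_mat_carrier] u(2) by simp
    moreover have "merges (int m) (W (mm ?v ?b)) (W (mm ?v ?b * ?r))"
      using merge[OF v] cyc_split[OF u(1) assms(2-4) True] by blast
    ultimately show ?thesis using w' by simp
  qed
qed

lemma weights_mult_reflection: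
  assumes "w \<in> G" "r \<in> R"
  shows "shifts (int p) (W w) (W (w * r)) \<or> merges (int m) (W w) (W (w * r))
    \<or> merges (int m) (W (w * r)) (W w)"
  using assms(2)
proof (cases rule: reflection_cases)
  case (swap i j k)
  then show ?thesis using weights_swap[OF assms(1)] by blast
next
  case (unit i k)
  from assms(1) obtain u a where u: "u permutes {..<n}" "w = mm u a" "W w = cycle_weights m n u a" by (rule G_E)
  have C: "cyc u i \<in> cycles_of n u" using unit by (simp add: cycles_of_eq)
  have "W (w * r) = cycle_weights m n u (\<lambda>c. unit_wt i k c + a c)"
    using weights_monomial_mat[OF m u(1)] unit u(2) by (simp add: mult_unit)
  moreover have pd: "int p dvd (k + x) mod int m - x mod int m" for x
  proof -
    have "int m dvd ((k + x) mod int m - x mod int m) - k"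
      by (simp add: mod_eq_dvd_iff[symmetric] mod_simps)
    then have "int p dvd ((k + x) mod int m - x mod int m) - k" using ipm dvd_trans by blast
    then show ?thesis using unit(2) dvd_of_dvd_diff by blast
  qed
  ultimately have "shifts (int p) (W w) (W (w * r))"
    unfolding u(3) by (intro shiftsI[OF cycle_weights_shift(1)[OF u(1) C cyc_self] _ pd])
      (simp only: cycle_weights_shift(2)[OF u(1) C cyc_self])
  then show ?thesis by blast
qed

lemma merge_weights:
  assumes "w \<in> G" "W w = M0 + {#x, y#}"
  obtains r z where "r \<in> R" "int m dvd z - (x + y)" "W (w * r) = M0 + {#z#}"
proof -
  from assms(1) obtain u a where u: "u permutes {..<n}" "w = mm u a" "W w = cycle_weights m n u a" by (rule G_E)
  let ?f = "\<lambda>C. wt a C mod int m" and ?S = "cycles_of n u"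
  have "image_mset ?f (mset_set ?S) = (M0 + {#y#}) + {#x#}"
    using assms(2) u by (simp add: cycle_weights_def add_mset_commute)
  from image_mset_mset_set_addE[OF this] obtain C where
    C: "C \<in> ?S" "?f C = x" "M0 + {#y#} = image_mset ?f (mset_set (?S - {C}))" by auto
  from image_mset_mset_set_addE[OF C(3)[symmetric]] obtain C' where
    C': "C' \<in> ?S - {C}" "?f C' = y" "M0 = image_mset ?f (mset_set (?S - {C} - {C'}))" by auto
  then have cc: "C' \<in> ?S" "C \<noteq> C'" by auto
  have "\<exists>i. i \<in> C" "\<exists>j. j \<in> C'"
    using C(1) cc(1) partition_onD3[OF partition_on_cycles_of[OF u(1)]] by (metis ex_in_conv)+
  then obtain i j where ij: "i \<in> C" "j \<in> C'" by auto
  have n: "i < n" "j < n" using cycles_of_bound[OF u(1)] C cc ij by blast+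
  have ne: "i \<noteq> j" using cycles_of_memD[OF u(1)] C cc ij by metis
  let ?r = "mm (transpose i j) (swap_wt i j 0)"
  have "W (w * ?r) = cycle_weights m n (u \<circ> transpose i j) (\<lambda>c. swap_wt i j 0 c + a (transpose i j c))"
    using mult_swap[OF u(1) n] weights_monomial_mat[OF m transpose_permutes[OF u(1) n]] u(2) by simp
  also have "\<dots> = M0 + {#(wt a C + wt a C') mod int m#}"
    using cycle_weights_merge(2)[OF u(1) C(1) cc ij, where m = m and a = a and k = 0] C'(3)
    by (simp add: Diff_insert2[symmetric] insert_commute)
  finally have "W (w * ?r) = M0 + {#(wt a C + wt a C') mod int m#}" .
  moreover have "int m dvd (wt a C + wt a C') mod int m - (x + y)"
    unfolding C(2)[symmetric] C'(2)[symmetric] by (simp add: mod_eq_dvd_iff[symmetric] mod_simps)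
  ultimately show thesis using that swap_reflection[OF n ne] by blast
qed

text \<open>The reflection is diagonal, with weight \<open>- x\<close> at any point of a cycle of
  weight \<open>x\<close>. Divisibility by \<open>p\<close> puts it into \<open>G\<close>, and
  nondivisibility by \<open>m\<close> keeps it from being the identity.\<close>

lemma kill_weight:
  assumes "w \<in> G" "W w = M0 + {#x#}" "int p dvd x" "\<not> int m dvd x"
  obtains r where "r \<in> R" "W (w * r) = M0 + {#0#}"
proof -
  from assms(1) obtain u a where u: "u permutes {..<n}" "w = mm u a" "W w = cycle_weights m n u a" by (rule G_E)
  let ?f = "\<lambda>C. wt a C mod int m" and ?S = "cycles_of n u"
  have "image_mset ?f (mset_set ?S) = M0 + {#x#}"
    using assms(2) u by (simp add: cycle_weights_def add_mset_commute)
  from image_mset_mset_set_addE[OF this] obtain C where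
    C: "C \<in> ?S" "?f C = x" "M0 = image_mset ?f (mset_set (?S - {C}))" by auto
  have "\<exists>i. i \<in> C"
    using C(1) partition_onD3[OF partition_on_cycles_of[OF u(1)]] by (metis ex_in_conv)
  then obtain i where i: "i \<in> C" by auto
  then have n: "i < n" using cycles_of_bound[OF u(1)] C by blast
  let ?r = "mm id (unit_wt i (- x))"
  have "W (w * ?r) = M0 + {#(- x + wt a C) mod int m#}"
    using weights_monomial_mat[OF m u(1)] u(2) cycle_weights_shift(2)[OF u(1) C(1) i, where m = m and a = a and k = "- x"] C(3)
    by (simp add: mult_unit)
  moreover have "(- x + wt a C) mod int m = 0"
    unfolding C(2)[symmetric] by (simp add: mod_simps)
  moreover have "?r \<in> R" using unit_reflection[OF n] assms by simp
  ultimately show thesis using that by simp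
qed

lemma split_null:
  assumes "w \<in> G" "\<And>x. x \<in># W w \<Longrightarrow> x = 0" "w \<noteq> 1\<^sub>m n"
  obtains r where "r \<in> R" "W (w * r) = W w + {#0#}"
proof -
  from assms(1) obtain u a where u: "u permutes {..<n}" "w = mm u a" "W w = cycle_weights m n u a" by (rule G_E)
  have null: "int m dvd wt a C" if "C \<in> cycles_of n u" for C
    using assms(2)[of "wt a C mod int m"] that u by (auto simp: cycle_weights_def)
  have "u \<noteq> id"
  proof
    assume id: "u = id"
    then have "a i mod int m = 0 mod int m" if "i < n" for i
      using null[of "{i}"] that by (simp add: cycles_of_id wt_def)
    then have "w = mm id (\<lambda>_. 0)" using u(2) id monomial_mat_cong[OF m, of n a "\<lambda>_. 0"] by simp
    then show False using assms(3) by (simp add: monomial_mat_one)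
  qed
  then obtain i where i: "u i \<noteq> i" by fastforce
  define j where "j = u i"
  \<comment> \<open>With \<open>k = a i\<close> the new fixed point \<open>j\<close> receives the
    weight \<open>- a i + a i = 0\<close>, so the other part keeps the whole weight of the
    cycle.\<close>
  let ?v = "u \<circ> transpose i j" and ?b = "\<lambda>c. swap_wt i j (a i) c + a (transpose i j c)"
  note t = cycles_of_split_image[OF u(1) i, folded j_def]
  have ij: "i < n" "j < n" "i \<noteq> j" using t i by (auto simp: j_def)
  let ?r = "mm (transpose i j) (swap_wt i j (a i))"
  have wr: "w * ?r = mm ?v ?b" using mult_swap[OF u(1) ij(1,2)] u(2) by simp
  have "w * ?r * ?r = w * (?r * ?r)" unfolding u(2) by (rule assoc_mult_mat) (rule monomial_mat_carrier)+
  then have "w * ?r * ?r = w" using swap_swap[OF ij] right_mult_one_mat[OF monomial_mat_carrier] u(2) by simp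
  then have "W w = W (mm ?v ?b * ?r)" using wr by simp
  also have "\<dots> = cycle_weights m n (?v \<circ> transpose i j) (\<lambda>c. swap_wt i j (a i) c + ?b (transpose i j c))"
    unfolding mult_swap[OF t(3) ij(1,2)]
    by (rule weights_monomial_mat[OF m transpose_permutes[OF t(3) ij(1,2)]])
  also note cycle_weights_merge(2)[OF t(3,5,4,6) cyc_self singletonI]
  finally have Ww: "W w = image_mset (\<lambda>C. wt ?b C mod int m) (mset_set (cycles_of n ?v - {cyc ?v i, {j}}))
      + {#(wt ?b (cyc ?v i) + wt ?b {j}) mod int m#}" .
  have "W (w * ?r) = cycle_weights m n ?v ?b" unfolding wr by (rule weights_monomial_mat[OF m t(3)])
  also note cycle_weights_merge(1)[OF t(3,5,4,6) cyc_self singletonI]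
  finally have Wwr: "W (w * ?r) = image_mset (\<lambda>C. wt ?b C mod int m) (mset_set (cycles_of n ?v - {cyc ?v i, {j}}))
      + {#wt ?b (cyc ?v i) mod int m, wt ?b {j} mod int m#}" .
  have wj: "wt ?b {j} = 0" using ij by (simp add: wt_def swap_wt_def)
  have "W (w * ?r) = W w + {#0#}" unfolding Ww Wwr wj by (simp add: add_mset_commute)
  then show thesis using that swap_reflection[OF ij] by blast
qed

end

section \<open>Reflection length\<close>

context gmpn
begin

definition word :: "nat \<Rightarrow> complex mat \<Rightarrow> bool" where
  "word k w \<longleftrightarrow> (\<exists>rs. length rs = k \<and> set rs \<subseteq> R \<and> foldr (*) rs (1\<^sub>m n) = w)"

lemma foldr_mult:
  assumes "set rs \<subseteq> R" "x \<in> G"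
  shows "foldr (*) rs (1\<^sub>m n) \<in> G \<and> foldr (*) rs x = foldr (*) rs (1\<^sub>m n) * x"
  using assms(1)
proof (induction rs)
  case Nil
  then show ?case using G_one assms(2) G_carrier[OF assms(2)] by simp
next
  case (Cons r rs)
  then have r: "r \<in> G" and IH: "foldr (*) rs (1\<^sub>m n) \<in> G" "foldr (*) rs x = foldr (*) rs (1\<^sub>m n) * x"
    using reflection_in_G by auto
  have "r * (foldr (*) rs (1\<^sub>m n) * x) = r * foldr (*) rs (1\<^sub>m n) * x"
    using assoc_mult_mat[OF G_carrier[OF r] G_carrier[OF IH(1)] G_carrier[OF assms(2)]] by simp
  then show ?case using G_mult[OF r IH(1)] IH(2) by simp
qed

lemma word_in_G: "word k w \<Longrightarrow> w \<in> G"
  unfolding word_def using foldr_mult[OF _ G_one] by blast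

lemma word_0 [simp]: "word 0 w \<longleftrightarrow> w = 1\<^sub>m n"
  by (auto simp: word_def)

lemma word_append:
  assumes "word k x" "word l y"
  shows "word (k + l) (x * y)"
proof -
  obtain rs ss where rs: "length rs = k" "set rs \<subseteq> R" "foldr (*) rs (1\<^sub>m n) = x"
    and ss: "length ss = l" "set ss \<subseteq> R" "foldr (*) ss (1\<^sub>m n) = y"
    using assms by (auto simp: word_def)
  have "foldr (*) (rs @ ss) (1\<^sub>m n) = x * y"
    using foldr_mult[OF rs(2) word_in_G[OF assms(2)]] rs ss by simp
  then show ?thesis unfolding word_def using rs ss by (intro exI[of _ "rs @ ss"]) auto
qed

lemma word_1: "r \<in> R \<Longrightarrow> word 1 r"
  unfolding word_def
  using right_mult_one_mat[OF G_carrier[OF reflection_in_G, of r]] by (intro exI[of _ "[r]"]) simp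

lemma word_SucE:
  assumes "word (Suc k) w"
  obtains w' r where "word k w'" "r \<in> R" "w = w' * r"
proof -
  obtain rs where rs: "length rs = Suc k" "set rs \<subseteq> R" "foldr (*) rs (1\<^sub>m n) = w"
    using assms by (auto simp: word_def)
  then obtain ss r where ss: "rs = ss @ [r]" by (metis length_Suc_conv_rev)
  then have r: "r \<in> R" "set ss \<subseteq> R" "length ss = k" using rs by auto
  have "w = foldr (*) ss r" using rs ss G_carrier[OF reflection_in_G[OF r(1)]] by simp
  then have "w = foldr (*) ss (1\<^sub>m n) * r" using foldr_mult[OF r(2) reflection_in_G[OF r(1)]] by simp
  then show thesis using that r unfolding word_def by blast
qed

lemma lenR_eq: "lenR m p n w = (LEAST k. word k w)"
  by (simp add: lenR_def word_def)

text \<open>If no merge is available, all weights are divisible by \<open>p\<close> and the cost is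
  minus the number of null weights. It then suffices to gain a null weight while the other weights
  stay as they are: a nonnull weight is killed or, if all are 0, a fixed point is split off, which
  is possible because \<open>w\<close> is not the identity.\<close>

lemma reflection_lowering_cost:
  assumes "w \<in> G" "null_partition (int p) (W w) D" "w \<noteq> 1\<^sub>m n"
  obtains r D' where "r \<in> R" "null_partition (int p) (W (w * r)) D'" "cost (int m) D' = cost (int m) D - 1"
  using ipm assms(2)
proof (cases rule: null_partition_descent)
  case (merge M0 x y)
  obtain r z where "r \<in> R" "int m dvd z - (x + y)" "W (w * r) = M0 + {#z#}"
    using merge_weights[OF assms(1) merge(1)] .
  then show thesis using that merge(2) by metis
next
  case single
  show thesis
  proof (cases "\<exists>x\<in>#W w. \<not> int m dvd x")
    case True
    then obtain x M0 where x: "\<not> int m dvd x" "W w = M0 + {#x#}"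
      by (metis add_mset_add_single multi_member_split)
    have p: "int p dvd x" using single(1) x(2) by simp
    obtain r where r: "r \<in> R" "W (w * r) = M0 + {#0#}" using kill_weight[OF assms(1) x(2) p x(1)] .
    have "paired (int m) (int p) (W (w * r))"
      using r x(2) single(1) by (intro paired_if_all_dvd) auto
    from cost_if_paired[OF ipm this] obtain D' where
      "null_partition (int p) (W (w * r)) D'" "cost (int m) D' = - int (zeros (int m) (W (w * r)))" by auto
    then show thesis using that r x single(2) by auto
  next
    case False
    have "x = 0" if "x \<in># W w" for x
      using that False weights_range[OF assms(1) that] m eq_if_dvd_diff[of x "int m" 0] by simp
    then obtain r where r: "r \<in> R" "W (w * r) = W w + {#0#}" using split_null[OF assms(1) _ assms(3)] by blast
    have "paired (int m) (int p) (W (w * r))"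
      using r single(1) by (intro paired_if_all_dvd) auto
    from cost_if_paired[OF ipm this] obtain D' where
      "null_partition (int p) (W (w * r)) D'" "cost (int m) D' = - int (zeros (int m) (W (w * r)))" by auto
    then show thesis using that r single(2) by auto
  qed
qed

text \<open>The measure \<open>n + cost\<close> is nonnegative on all of \<open>G\<close>, since the
  cost is at least \<open>- zeros\<close> and \<open>zeros\<close> is at most \<open>n\<close>.
  Hence the descent terminates, and it can stop only at the identity.\<close>

lemma word_if_null_partition:
  assumes "w \<in> G" "null_partition (int p) (W w) D"
  shows "\<exists>k. int k \<le> int n + cost (int m) D \<and> word k w"
  using assms
proof (induction "nat (int n + cost (int m) D)" arbitrary: w D rule: less_induct)
  case less
  have nonneg: "0 \<le> int n + cost (int m) D'" if "x \<in> G" "null_partition (int p) (W x) D'" for x D'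
    using cost_ge[OF that(2), of "int m"] codimfix_weights(2)[OF that(1)] by simp
  show ?case
  proof (cases "w = 1\<^sub>m n")
    case True
    then show ?thesis using nonneg[OF less.prems] by (intro exI[of _ 0]) simp
  next
    case False
    from reflection_lowering_cost[OF less.prems False] obtain r D' where
      r: "r \<in> R" "null_partition (int p) (W (w * r)) D'" "cost (int m) D' = cost (int m) D - 1" .
    have wr: "w * r \<in> G" using less.prems(1) reflection_in_G[OF r(1)] by (rule G_mult)
    have "0 \<le> int n + cost (int m) D'" using nonneg[OF wr r(2)] .
    then have "nat (int n + cost (int m) D') < nat (int n + cost (int m) D)" using r(3) by simp
    from less.hyps[OF this wr r(2)] obtain k where k: "int k \<le> int n + cost (int m) D'" "word k (w * r)" by auto
    obtain r' where r': "r' \<in> R" "r * r' = 1\<^sub>m n" using reflection_inv[OF r(1)] .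
    have "w * r * r' = w * (r * r')"
      using assoc_mult_mat[OF G_carrier[OF less.prems(1)] G_carrier[OF reflection_in_G[OF r(1)]]
        G_carrier[OF reflection_in_G[OF r'(1)]]] .
    then have "w * r * r' = w" using r'(2) G_carrier[OF less.prems(1)] by simp
    then have "word (k + 1) w" using word_append[OF k(2) word_1[OF r'(1)]] by simp
    then show ?thesis using k(1) r(3) by (intro exI[of _ "k + 1"]) simp
  qed
qed

text \<open>The identity has \<open>n\<close> null weights and thus a partition of cost
  \<open>- n\<close>; each letter of the word raises the cost by at most 1.\<close>

lemma null_partition_if_word:
  "word k w \<Longrightarrow> \<exists>D. null_partition (int p) (W w) D \<and> int n + cost (int m) D \<le> int k"
proof (induction k arbitrary: w)
  case 0
  then have "paired (int m) (int p) (W w)"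
    by (intro paired_if_all_dvd) (simp add: weights_one split: if_splits)
  from cost_if_paired[OF ipm this] show ?case using 0 by (auto simp: weights_one zeros_replicate)
next
  case (Suc k)
  from word_SucE[OF Suc.prems] obtain w' r where w: "word k w'" "r \<in> R" "w = w' * r" .
  from Suc.IH[OF w(1)] obtain D where D: "null_partition (int p) (W w') D" "int n + cost (int m) D \<le> int k" by auto
  have "\<exists>D'. null_partition (int p) (W w) D' \<and> cost (int m) D' \<le> cost (int m) D + 1"
    using weights_mult_reflection[OF word_in_G[OF w(1)] w(2)] w(3)
      cost_shift[OF _ D(1)] cost_merge[OF ipm _ D(1)] cost_unmerge[OF ipm _ D(1)] by metis
  then show ?case using D(2) by force
qed

lemma ex_null_partition: "w \<in> G \<Longrightarrow> \<exists>D. null_partition (int p) (W w) D"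
proof (cases "W w = {#}")
  case False
  assume "w \<in> G"
  then show ?thesis using False dvd_sum_weights by (intro exI[of _ "{#W w#}"]) (simp add: null_partition_def)
qed (auto intro: exI[of _ "{#}"])

lemma word_lenR: "w \<in> G \<Longrightarrow> word (lenR m p n w) w"
  unfolding lenR_eq using ex_null_partition word_if_null_partition by (metis LeastI_ex)

lemma lenR_le_word: "word k w \<Longrightarrow> lenR m p n w \<le> k"
  unfolding lenR_eq by (rule Least_le)

lemma lenR_le_cost:
  assumes "w \<in> G" "null_partition (int p) (W w) D"
  shows "int (lenR m p n w) \<le> int n + cost (int m) D"
  using word_if_null_partition[OF assms] lenR_le_word by fastforce

lemma lenR_eq_cost:
  assumes "w \<in> G"
  obtains D where "null_partition (int p) (W w) D" "int (lenR m p n w) = int n + cost (int m) D"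
  using null_partition_if_word[OF word_lenR[OF assms]] lenR_le_cost[OF assms] that by (metis order_antisym)

lemma codimfix_le_lenR:
  assumes "w \<in> G"
  shows "codimfix n w \<le> lenR m p n w"
proof -
  from lenR_eq_cost[OF assms] obtain D where D: "null_partition (int p) (W w) D"
    "int (lenR m p n w) = int n + cost (int m) D" .
  show ?thesis using cost_ge[OF D(1), of "int m"] D(2) codimfix_weights(3)[OF assms] by simp
qed

lemma lenR_eq_codimfix_iff:
  assumes "w \<in> G"
  shows "lenR m p n w = codimfix n w \<longleftrightarrow> paired (int m) (int p) (W w)"
proof
  assume eq: "lenR m p n w = codimfix n w"
  from lenR_eq_cost[OF assms] obtain D where D: "null_partition (int p) (W w) D"
    "int (lenR m p n w) = int n + cost (int m) D" .
  then show "paired (int m) (int p) (W w)"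
    using eq codimfix_weights(3)[OF assms] by (intro paired_if_cost[OF D(1)]) simp
next
  assume "paired (int m) (int p) (W w)"
  from cost_if_paired[OF ipm this] obtain D where
    "null_partition (int p) (W w) D" "cost (int m) D = - int (zeros (int m) (W w))" by auto
  then have "int (lenR m p n w) \<le> int (codimfix n w)"
    using lenR_le_cost[OF assms] codimfix_weights(3)[OF assms] by fastforce
  then show "lenR m p n w = codimfix n w" using codimfix_le_lenR[OF assms] by simp
qed

lemma lenR_mult_le: "x \<in> G \<Longrightarrow> y \<in> G \<Longrightarrow> lenR m p n (x * y) \<le> lenR m p n x + lenR m p n y"
  by (intro lenR_le_word word_append word_lenR)

end

text \<open>For \<open>p = 1\<close> reflection length and codimension agree, so the codimension order of
  \<open>G(m,p,n)\<close> can be studied along reduced words in the reflections of \<open>G(m,1,n)\<close>.\<close>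
locale gm1n = gmpn m 1 n for m n
begin

lemma lenR_eq_codimfix: "w \<in> G \<Longrightarrow> lenR m 1 n w = codimfix n w"
  by (subst lenR_eq_codimfix_iff) (auto intro: paired_if_all_dvd)

text \<open>Subadditivity is inherited from word length, since words concatenate.\<close>

lemma codimfix_mult_le: "x \<in> G \<Longrightarrow> y \<in> G \<Longrightarrow> codimfix n (x * y) \<le> codimfix n x + codimfix n y"
  using lenR_mult_le lenR_eq_codimfix G_mult by metis

lemma nonnull_mult_reflection:
  assumes "x \<in> G" "r \<in> R" "codimfix n (x * r) = Suc (codimfix n x)"
  shows "nonnull (int m) (W x) \<subseteq># nonnull (int m) (W (x * r))"
proof -
  have xr: "x * r \<in> G" using assms(1) reflection_in_G[OF assms(2)] by (rule G_mult)
  have z: "zeros (int m) (W x) = Suc (zeros (int m) (W (x * r)))"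
    using assms(3) codimfix_weights(3)[OF assms(1)] codimfix_weights(3)[OF xr] by simp
  have "0 \<le> y \<and> y < int m" if "y \<in># W x + W (x * r)" for y
    using that weights_range[OF assms(1)] weights_range[OF xr] by auto
  then show ?thesis
    using weights_mult_reflection[OF assms(1,2)] nonnull_shifts[OF _ z] nonnull_merges[OF _ z] nonnull_unmerges[OF _ z]
    by blast
qed

text \<open>Each letter raises the codimension by at most 1 and the total rise is \<open>k\<close>,
  so every letter raises it by exactly 1 and costs one null weight.\<close>

lemma nonnull_mult_word:
  assumes "x \<in> G"
  shows "word k y \<Longrightarrow> codimfix n (x * y) = codimfix n x + k \<Longrightarrow>
    nonnull (int m) (W x) \<subseteq># nonnull (int m) (W (x * y))"
proof (induction k arbitrary: y)
  case 0
  then have "y = 1\<^sub>m n" by (simp only: word_0)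
  then show ?case using G_carrier[OF assms] by simp
next
  case (Suc k)
  from word_SucE[OF Suc.prems(1)] obtain y' r where y: "word k y'" "r \<in> R" "y = y' * r" .
  have y': "y' \<in> G" using word_in_G[OF y(1)] .
  have r: "r \<in> G" "codimfix n r = 1" using y(2) by (auto simp: reflections_def)
  have xy': "x * y' \<in> G" using assms y' by (rule G_mult)
  have xy: "x * y = x * y' * r"
    unfolding y(3) using assoc_mult_mat[OF G_carrier[OF assms] G_carrier[OF y'] G_carrier[OF r(1)]] by simp
  have "codimfix n y' \<le> k" using lenR_le_word[OF y(1)] lenR_eq_codimfix[OF y'] by simp
  then have "codimfix n (x * y') \<le> codimfix n x + k" using codimfix_mult_le[OF assms y'] by simp
  moreover have "codimfix n (x * y) \<le> codimfix n (x * y') + 1"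
    unfolding xy using codimfix_mult_le[OF xy' r(1)] r(2) by simp
  ultimately have e: "codimfix n (x * y') = codimfix n x + k" "codimfix n (x * y' * r) = Suc (codimfix n (x * y'))"
    using Suc.prems(2) xy by simp_all
  show ?case
    using Suc.IH[OF y(1) e(1)] nonnull_mult_reflection[OF xy' y(2) e(2)] xy by simp
qed

lemma nonnull_subset_if_codimfix_add:
  assumes "x \<in> G" "y \<in> G" "codimfix n x + codimfix n y = codimfix n (x * y)"
  shows "nonnull (int m) (W x) \<subseteq># nonnull (int m) (W (x * y))"
  using nonnull_mult_word[OF assms(1) word_lenR[OF assms(2)]] assms(3) lenR_eq_codimfix[OF assms(2)] by simp

text \<open>Every weight is divisible by 1, so the nonnull weights in \<open>B\<close> can be killed
  one at a time by diagonal reflections of G(m,1,n), whose inverses are collected in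
  \<open>y\<close>.\<close>

lemma codimfix_below_with_weights:
  assumes "w \<in> G" "W w = A + B"
  shows "\<exists>x\<in>G. \<exists>y\<in>G. w = x * y \<and> W x = A + replicate_mset (size B) 0 \<and>
    codimfix n x + codimfix n y = codimfix n w"
  using assms(2)
proof (induction B arbitrary: A)
  case empty
  have "codimfix n (1\<^sub>m n) = 0" using codimfix_weights(1)[OF G_one] by (simp add: weights_one zeros_replicate)
  then show ?case
    using empty assms(1) G_one G_carrier[OF assms(1)] by (intro bexI[of _ w] bexI[of _ "1\<^sub>m n"]) auto
next
  case (add b B)
  have "W w = (A + {#b#}) + B" using add.prems by simp
  from add.IH[OF this] obtain x y where xy: "x \<in> G" "y \<in> G" "w = x * y"
    "W x = A + {#b#} + replicate_mset (size B) 0" "codimfix n x + codimfix n y = codimfix n w" by blast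
  show ?case
  proof (cases "int m dvd b")
    case True
    have "b \<in># W x" using xy(4) by simp
    then have "b = 0" using weights_range[OF xy(1)] True m eq_if_dvd_diff[of b "int m" 0] by simp
    then have "W x = A + replicate_mset (size (add_mset b B)) 0" using xy(4) by simp
    then show ?thesis using xy by blast
  next
    case False
    have "W x = (A + replicate_mset (size B) 0) + {#b#}" using xy(4) by simp
    from kill_weight[OF xy(1) this _ False] obtain r where
      r: "r \<in> R" "W (x * r) = A + replicate_mset (size B) 0 + {#0#}" by auto
    obtain r' where r': "r' \<in> R" "r * r' = 1\<^sub>m n" using reflection_inv[OF r(1)] .
    have rG: "r \<in> G" "r' \<in> G" "codimfix n r' = 1" using r(1) r'(1) by (auto simp: reflections_def)
    have xr: "x * r \<in> G" and ry: "r' * y \<in> G" using xy rG G_mult by auto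
    note car = G_carrier[OF xy(1)] G_carrier[OF rG(1)] G_carrier[OF rG(2)] G_carrier[OF xy(2)]
    have "x * r * (r' * y) = x * (r * (r' * y))" using assoc_mult_mat[OF car(1,2) G_carrier[OF ry]] .
    also have "r * (r' * y) = r * r' * y" using assoc_mult_mat[OF car(2,3,4)] by simp
    finally have w: "w = x * r * (r' * y)" using r'(2) xy(3) car by simp
    \<comment> \<open>The codimension of the left factor drops by 1 and that of the right factor
      rises by at most 1. Subadditivity bounds the sum from below, so it is unchanged.\<close>
    have "Suc (codimfix n (x * r)) = codimfix n x"
      using codimfix_weights(3)[OF xy(1)] codimfix_weights(3)[OF xr] r(2) xy(4) False by simp
    moreover have "codimfix n (r' * y) \<le> 1 + codimfix n y" using codimfix_mult_le[OF rG(2) xy(2)] rG(3) by simp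
    moreover have "codimfix n w \<le> codimfix n (x * r) + codimfix n (r' * y)" unfolding w by (rule codimfix_mult_le[OF xr ry])
    ultimately have "codimfix n (x * r) + codimfix n (r' * y) = codimfix n w" using xy(5) by simp
    moreover have "W (x * r) = A + replicate_mset (size (add_mset b B)) 0" using r(2) by simp
    ultimately show ?thesis using xr ry w by blast
  qed
qed

end

section \<open>The intervals\<close>

context gmpn
begin

sublocale G1: gm1n m n
  by unfold_locales (use m in auto)

lemma G_subset: "w \<in> G \<Longrightarrow> w \<in> Gmpn m 1 n"
  by (auto simp: Gmpn_def)

lemma G_if_dvd_sum_weights:
  assumes "w \<in> Gmpn m 1 n" "int p dvd \<Sum>\<^sub># (W w)"
  shows "w \<in> G"
proof -
  from assms(1) obtain u a where "u permutes {..<n}" "w = mm u a" "W w = cycle_weights m n u a"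
    by (rule G1.G_E)
  then show ?thesis using assms(2) pm G_I by (simp add: dvd_sum_cycle_weights)
qed

lemma interval_f_iff:
  "w \<in> G \<Longrightarrow> x \<in> interval_f m p n f w \<longleftrightarrow> x \<in> G \<and> (\<exists>y\<in>G. w = x * y \<and> f x + f y = f w)"
  unfolding interval_f_def using le_f_mult_iff G_divideE by (smt (verit, best) mem_Collect_eq)

definition balanced :: "complex mat \<Rightarrow> bool" where
  "balanced w \<longleftrightarrow> (\<forall>A. A \<subseteq># W w \<longrightarrow> int p dvd \<Sum>\<^sub># A \<longrightarrow> paired (int m) (int p) A)"

text \<open>The nonnull weights of \<open>x\<close> come from \<open>w\<close>, and their sum is 0
  modulo \<open>p\<close> because the null ones contribute a multiple of \<open>p\<close>. The null
  weights then rejoin the pairing as singletons.\<close>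

lemma lenR_eq_codimfix_below:
  assumes "w \<in> G" "balanced w" "x \<in> G" "y \<in> G" "w = x * y" "codimfix n x + codimfix n y = codimfix n w"
  shows "lenR m p n x = codimfix n x"
proof -
  let ?N = "nonnull (int m) (W x)" and ?Z = "filter_mset (\<lambda>x. int m dvd x) (W x)"
  have "?N \<subseteq># nonnull (int m) (W w)"
    using G1.nonnull_subset_if_codimfix_add[OF G_subset G_subset] assms by simp
  then have N: "?N \<subseteq># W w" using multiset_filter_subset subset_mset.order_trans by blast
  have Wx: "W x = ?N + ?Z" by (metis multiset_partition union_commute)
  have Z: "int p dvd z" if "z \<in># ?Z" for z using that dvd_trans[OF ipm] by auto
  have "int p dvd \<Sum>\<^sub># ?N + \<Sum>\<^sub># ?Z" using dvd_sum_weights[OF assms(3)] Wx by (metis sum_mset.union)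
  then have "int p dvd \<Sum>\<^sub># ?N" using sum_mset_dvd[of ?Z "int p", OF Z] by (metis dvd_add_left_iff)
  then have "paired (int m) (int p) ?N" using assms(2) N by (simp add: balanced_def)
  then have "paired (int m) (int p) (W x)" using paired_add[OF _ paired_if_all_dvd[OF Z]] Wx by metis
  then show ?thesis using lenR_eq_codimfix_iff[OF assms(3)] by simp
qed

lemma balanced_imp_intervals_eq:
  assumes "w \<in> G" "balanced w"
  shows "interval_f m p n (lenR m p n) w = interval_f m p n (codimfix n) w"
proof -
  have "paired (int m) (int p) (W w)" using assms dvd_sum_weights by (simp add: balanced_def)
  then have w: "lenR m p n w = codimfix n w" using lenR_eq_codimfix_iff[OF assms(1)] by simp
  have key: "lenR m p n x + lenR m p n y = lenR m p n w \<longleftrightarrow> codimfix n x + codimfix n y = codimfix n w"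
    if xy: "x \<in> G" "y \<in> G" "w = x * y" for x y
  proof
    \<comment> \<open>The codimension of \<open>w\<close> is at most the sum of the codimensions,
      which is at most the sum of the lengths, and that equals the codimension of \<open>w\<close>
      again.\<close>
    assume "lenR m p n x + lenR m p n y = lenR m p n w"
    then show "codimfix n x + codimfix n y = codimfix n w"
      using codimfix_le_lenR[OF xy(1)] codimfix_le_lenR[OF xy(2)] w
        G1.codimfix_mult_le[OF G_subset[OF xy(1)] G_subset[OF xy(2)]] xy(3) by simp
  next
    \<comment> \<open>\<open>lenR_eq_codimfix_below\<close> speaks of left factors. With
      \<open>z\<close> the inverse of \<open>y\<close>, writing \<open>w = y * (z * x * y)\<close>
      makes \<open>y\<close> one, and the conjugate has the codimension of \<open>x\<close>.\<close>
    assume c: "codimfix n x + codimfix n y = codimfix n w"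
    obtain z where z: "z \<in> G" "z * y = 1\<^sub>m n" "y * z = 1\<^sub>m n" using G_inv[OF xy(2)] .
    let ?x = "z * x * y"
    have xG: "?x \<in> G" using z xy G_mult by simp
    note car = G_carrier[OF xy(1)] G_carrier[OF xy(2)] G_carrier[OF z(1)]
    have "y * ?x = y * (z * (x * y))" using assoc_mult_mat[OF car(3,1,2)] by simp
    also have "\<dots> = y * z * (x * y)"
      using assoc_mult_mat[OF car(2,3), of "x * y" n] car by simp
    finally have "w = y * ?x" using z(3) xy(3) car by simp
    moreover have "codimfix n ?x = codimfix n x" using codimfix_similar[OF car(1,3,2) z(2,3)] .
    ultimately have "lenR m p n y = codimfix n y"
      using lenR_eq_codimfix_below[OF assms xy(2) xG] c by simp
    moreover have "lenR m p n x = codimfix n x" using lenR_eq_codimfix_below[OF assms xy c] .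
    ultimately show "lenR m p n x + lenR m p n y = lenR m p n w" using c w by simp
  qed
  show ?thesis
  proof (rule Set.set_eqI)
    fix x
    show "x \<in> interval_f m p n (lenR m p n) w \<longleftrightarrow> x \<in> interval_f m p n (codimfix n) w"
      unfolding interval_f_iff[OF assms(1)] using key[of x] by metis
  qed
qed

text \<open>The separating element is \<open>w * r\<close> with \<open>r\<close> the merge of
  \<open>bad_merge_if_not_paired\<close>. Its length is one less than that of \<open>w\<close>, but
  it has no more null weights, so its codimension is at least that of \<open>w\<close> and adding
  that of \<open>r'\<close> overshoots.\<close>

lemma intervals_eq_imp_paired:
  assumes "w \<in> G" and eq: "interval_f m p n (lenR m p n) w = interval_f m p n (codimfix n) w"
  shows "paired (int m) (int p) (W w)"
proof (rule ccontr)
  assume np: "\<not> ?thesis"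
  from lenR_eq_cost[OF assms(1)] obtain D where D: "null_partition (int p) (W w) D"
    "int (lenR m p n w) = int n + cost (int m) D" .
  have opt: "cost (int m) D \<le> cost (int m) D'" if "null_partition (int p) (W w) D'" for D'
    using lenR_le_cost[OF assms(1) that] D(2) by simp
  from bad_merge_if_not_paired[OF ipm D(1) np opt] obtain M0 x y where
    M: "W w = M0 + {#x, y#}"
      "\<And>z. int m dvd z - (x + y) \<Longrightarrow> \<exists>D'. null_partition (int p) (M0 + {#z#}) D' \<and> cost (int m) D' = cost (int m) D - 1"
      "\<And>z. int m dvd z - (x + y) \<Longrightarrow> zeros (int m) (M0 + {#z#}) \<le> zeros (int m) (W w)"
    by metis
  from merge_weights[OF assms(1) M(1)] obtain r z where
    r: "r \<in> R" "int m dvd z - (x + y)" "W (w * r) = M0 + {#z#}" .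
  obtain r' where r': "r' \<in> R" "r * r' = 1\<^sub>m n" using reflection_inv[OF r(1)] .
  have rG: "r \<in> G" "r' \<in> G" "codimfix n r' = 1" using r(1) r'(1) by (auto simp: reflections_def)
  have wr: "w * r \<in> G" using assms(1) rG G_mult by blast
  have w: "w = w * r * r'"
    using assoc_mult_mat[OF G_carrier[OF assms(1)] G_carrier[OF rG(1)] G_carrier[OF rG(2)]] r'(2) G_carrier[OF assms(1)] by simp
  obtain D' where D': "null_partition (int p) (W (w * r)) D'" "cost (int m) D' = cost (int m) D - 1"
    using M(2)[OF r(2)] r(3) by auto
  have "lenR m p n (w * r) + 1 \<le> lenR m p n w" using lenR_le_cost[OF wr D'(1)] D'(2) D(2) by simp
  moreover have "lenR m p n r' \<le> 1" using lenR_le_word[OF word_1[OF r'(1)]] .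
  moreover have "lenR m p n w \<le> lenR m p n (w * r) + lenR m p n r'" using lenR_mult_le[OF wr rG(2)] w by simp
  ultimately have "lenR m p n (w * r) + lenR m p n r' = lenR m p n w" by simp
  then have "w * r \<in> interval_f m p n (lenR m p n) w"
    using interval_f_iff[OF assms(1)] wr rG(2) w by blast
  then have "w * r \<in> interval_f m p n (codimfix n) w" using eq by simp
  then obtain y where y: "y \<in> G" "w = w * r * y" "codimfix n (w * r) + codimfix n y = codimfix n w"
    using interval_f_iff[OF assms(1)] by blast
  have "y = r'" using ginv_mult[OF wr y(1)] ginv_mult[OF wr rG(2)] y(2) w by simp
  then have "codimfix n (w * r) < codimfix n w" using y(3) rG(3) by simp
  moreover have "zeros (int m) (W (w * r)) \<le> zeros (int m) (W w)" using M(3)[OF r(2)] unfolding r(3) .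
  ultimately show False
    using codimfix_weights(3)[OF wr] codimfix_weights(3)[OF assms(1)] by linarith
qed

lemma intervals_eq_imp_balanced:
  assumes "w \<in> G" and eq: "interval_f m p n (lenR m p n) w = interval_f m p n (codimfix n) w"
  shows "balanced w"
  unfolding balanced_def
proof (intro allI impI)
  fix A assume A: "A \<subseteq># W w" "int p dvd \<Sum>\<^sub># A"
  have w: "lenR m p n w = codimfix n w"
    using intervals_eq_imp_paired[OF assms] lenR_eq_codimfix_iff[OF assms(1)] by simp
  obtain B where "W w = A + B" using A(1) by (metis subset_mset.add_diff_inverse)
  from G1.codimfix_below_with_weights[OF G_subset[OF assms(1)] this] obtain x y where
    xy: "x \<in> Gmpn m 1 n" "y \<in> Gmpn m 1 n" "w = x * y" "W x = A + replicate_mset (size B) 0"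
      "codimfix n x + codimfix n y = codimfix n w" by blast
  have x: "x \<in> G" using G_if_dvd_sum_weights[OF xy(1)] xy(4) A(2) by simp
  obtain y' where y': "y' \<in> G" "w = x * y'" using G_divideE[OF x assms(1)] .
  \<comment> \<open>Both \<open>x\<close> and \<open>w\<close> lie in \<open>G\<close>, hence so
    does the cofactor; cancellation in G(m,1,n) identifies it with \<open>y\<close>.\<close>
  have "y = y'" using G1.ginv_mult[OF xy(1,2)] G1.ginv_mult[OF xy(1) G_subset[OF y'(1)]] xy(3) y'(2) by simp
  then have "x \<in> interval_f m p n (codimfix n) w" using interval_f_iff[OF assms(1)] x y' xy(5) by blast
  then obtain z where z: "z \<in> G" "w = x * z" "lenR m p n x + lenR m p n z = lenR m p n w"
    using eq interval_f_iff[OF assms(1)] by blast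
  have "z = y'" using ginv_mult[OF x z(1)] ginv_mult[OF x y'(1)] z(2) y'(2) by simp
  \<comment> \<open>Each length is at least the corresponding codimension and the two sums agree, so
    both bounds are equalities.\<close>
  then have "lenR m p n x = codimfix n x"
    using z(3) w xy(5) \<open>y = y'\<close> codimfix_le_lenR[OF x] codimfix_le_lenR[OF y'(1)] by simp
  then have "paired (int m) (int p) (W x)" using lenR_eq_codimfix_iff[OF x] by simp
  then have "paired (int m) (int p) (A + replicate_mset (size B) 0)" using xy(4) by simp
  then show "paired (int m) (int p) A" by (rule paired_remove_null[OF ipm]) (simp split: if_splits)
qed

end

section \<open>From multisets of weights to sets of cycles\<close>

definition pairing :: "int \<Rightarrow> int \<Rightarrow> ('a \<Rightarrow> int) \<Rightarrow> 'a set set \<Rightarrow> bool" where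
  "pairing m p f P \<longleftrightarrow> (\<forall>B\<in>P. (\<exists>C. B = {C} \<and> p dvd f C) \<or>
     (\<exists>C C'. B = {C, C'} \<and> C \<noteq> C' \<and> m dvd f C + f C'))"

lemma paired_if_pairing:
  assumes pm: "p dvd m" and "finite P" "finite S" "partition_on S P" "pairing m p f P"
  shows "paired m p (image_mset (\<lambda>C. f C mod m) (mset_set S))"
  using assms(2-)
proof (induction P arbitrary: S rule: finite_induct)
  case empty
  then have "S = {}" by (simp add: partition_on_def)
  then show ?case by (simp add: paired.empty)
next
  case (insert B P)
  have "disjnt B (\<Union> P)"
    using insert.hyps(2) insert.prems(2) by (auto simp: partition_on_def disjoint_def disjnt_def)
  then have B: "partition_on (S - B) P" "B \<subseteq> S" using insert.prems(2) partition_on_insert by metis+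
  have "paired m p (image_mset (\<lambda>C. f C mod m) (mset_set (S - B)))"
    using insert.IH[OF _ B(1)] insert.prems(1,3) by (simp add: pairing_def)
  moreover have "paired m p (image_mset (\<lambda>C. f C mod m) (mset_set B))"
  proof -
    consider C where "B = {C}" "p dvd f C" | C C' where "B = {C, C'}" "C \<noteq> C'" "m dvd f C + f C'"
      using insert.prems(3) by (auto simp: pairing_def)
    then show ?thesis
    proof cases
      case 1
      then show ?thesis using paired.single[OF paired.empty, of p "f C mod m" m] pm by (simp add: dvd_mod_iff)
    next
      case 2
      then have "m dvd f C mod m + f C' mod m" by (simp add: dvd_eq_mod_eq_0 mod_simps)
      then show ?thesis using 2 paired.pair[OF paired.empty, of m "f C mod m" "f C' mod m" p] by simp
    qed
  qed
  moreover have "mset_set S = mset_set (S - B) + mset_set B"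
    using mset_set_Union[of "S - B" B] insert.prems(1) B(2) finite_subset[OF B(2)] Diff_disjoint[of B S]
    by (simp add: Un_absorb1 Un_commute Int_commute)
  ultimately show ?case using paired_add by (metis image_mset_union)
qed

text \<open>Each weight in the derivation of \<open>paired\<close> is traced back to some cycle
  carrying it. That cycle is removed before the next one is chosen, so equal weights cause no
  clash.\<close>

lemma pairing_if_paired:
  assumes pm: "p dvd m" and "paired m p M" "finite S" "image_mset (\<lambda>C. f C mod m) (mset_set S) = M"
  shows "\<exists>P. partition_on S P \<and> pairing m p f P"
  using assms(2-)
proof (induction arbitrary: S rule: paired.induct)
  case empty
  then have "S = {}" by (simp add: mset_set_empty_iff)
  then show ?case by (intro exI[of _ "{}"]) (simp add: pairing_def partition_on_def)
next
  case (single M x)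
  from image_mset_mset_set_addE[OF single.prems(2,1)] obtain C where
    C: "C \<in> S" "f C mod m = x" "M = image_mset (\<lambda>C. f C mod m) (mset_set (S - {C}))" .
  from single.IH[of "S - {C}"] C(3) single.prems(1) obtain P where
    P: "partition_on (S - {C}) P" "pairing m p f P" by auto
  have "disjnt {C} (\<Union> P)" using partition_onD1[OF P(1)] by auto
  then have "partition_on S (insert {C} P)" using P(1) C(1) by (simp add: partition_on_insert)
  moreover have "p dvd f C" using C(2) single.hyps(2) pm by (metis dvd_mod_iff)
  then have "pairing m p f (insert {C} P)" using P(2) by (auto simp: pairing_def)
  ultimately show ?case by blast
next
  case (pair M x y)
  have "image_mset (\<lambda>C. f C mod m) (mset_set S) = (M + {#x#}) + {#y#}" using pair.prems(2) by simp
  from image_mset_mset_set_addE[OF this pair.prems(1)] obtain C' where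
    C': "C' \<in> S" "f C' mod m = y" "M + {#x#} = image_mset (\<lambda>C. f C mod m) (mset_set (S - {C'}))" .
  from image_mset_mset_set_addE[OF C'(3)[symmetric]] pair.prems(1) obtain C where
    C: "C \<in> S - {C'}" "f C mod m = x" "M = image_mset (\<lambda>C. f C mod m) (mset_set (S - {C'} - {C}))" by auto
  have S: "S - {C'} - {C} = S - {C, C'}" by auto
  from pair.IH[of "S - {C, C'}"] C(3) pair.prems(1) S obtain P where
    P: "partition_on (S - {C, C'}) P" "pairing m p f P" by auto
  have "disjnt {C, C'} (\<Union> P)" using partition_onD1[OF P(1)] by auto
  then have "partition_on S (insert {C, C'} P)" using P(1) C(1) C'(1) by (simp add: partition_on_insert)
  moreover have "m dvd f C + f C'" using C(2) C'(2) pair.hyps(2) by (simp add: dvd_eq_mod_eq_0 mod_simps flip: C(2) C'(2))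
  then have "pairing m p f (insert {C, C'} P)" using P(2) C(1) by (auto simp: pairing_def)
  ultimately show ?case by blast
qed

lemma paired_iff_pairing:
  assumes "p dvd m" "finite S"
  shows "paired m p (image_mset (\<lambda>C. f C mod m) (mset_set S)) \<longleftrightarrow> (\<exists>P. partition_on S P \<and> pairing m p f P)"
  using paired_if_pairing[OF assms(1) _ assms(2)] pairing_if_paired[OF assms(1) _ assms(2) refl]
    finite_elements[OF assms(2)] by blast

lemma subset_image_mset_setE:
  assumes "finite S" "A \<subseteq># image_mset f (mset_set S)"
  obtains T where "T \<subseteq> S" "A = image_mset f (mset_set T)"
proof -
  have "\<exists>T\<subseteq>S. A = image_mset f (mset_set T)"
    using assms
  proof (induction S arbitrary: A rule: finite_induct)
    case (insert C S)
    show ?case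
    proof (cases "f C \<in># A")
      case True
      then obtain A' where A': "A = add_mset (f C) A'" by (meson multi_member_split)
      then obtain T where T: "T \<subseteq> S" "A' = image_mset f (mset_set T)" using insert by auto
      then have "C \<notin> T" "finite T" using insert.hyps finite_subset by auto
      then show ?thesis using T A' by (intro exI[of _ "insert C T"]) auto
    next
      case False
      then have "A \<subseteq># image_mset f (mset_set S)"
        using insert.prems insert.hyps
          subset_eq_diff_conv[of A "{#f C#}" "image_mset f (mset_set S)"] by (simp add: diff_single_trivial)
      then show ?thesis using insert.IH by (meson subset_insertI2)
    qed
  qed simp
  then show thesis using that by blast
qed

text \<open>The weights of all cycles sum to a multiple of \<open>p\<close>, so \<open>cond2\<close>
  partitions the full set. In a pair with null sum \<open>p\<close> divides both weights or neither,
  hence the blocks meeting the nondivisible weights consist of them entirely and are pairs.\<close>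

lemma cond2_imp_cond1:
  assumes "u permutes {..<n}" "p dvd m" "int p dvd wt a {..<n}" "cond2 m p n u a"
  shows "cond1 m p n u a"
proof -
  let ?S = "{C \<in> cycles_of n u. \<not> int p dvd wt a C}"
  have "int p dvd (\<Sum>C\<in>cycles_of n u. wt a C)" using assms(3) wt_eq_sum_cycles[OF assms(1)] by simp
  then obtain P where P: "partition_on (cycles_of n u) P"
    "\<And>B. B \<in> P \<Longrightarrow> (\<exists>C. B = {C} \<and> int p dvd wt a C) \<or>
      (\<exists>C C'. B = {C, C'} \<and> C \<noteq> C' \<and> int m dvd wt a C + wt a C')"
    using assms(4) unfolding cond2_def by (metis order_refl)
  have mixed: "int p dvd wt a C \<longleftrightarrow> int p dvd wt a C'" if "B \<in> P" "C \<in> B" "C' \<in> B" for B C C'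
  proof -
    have "int p dvd wt a D + wt a D'" if "int m dvd wt a D + wt a D'" for D D'
      using that assms(2) by (meson dvd_trans int_dvd_int_iff)
    then have "int p dvd wt a D \<longleftrightarrow> int p dvd wt a D'" if "int m dvd wt a D + wt a D'" for D D'
      using that by (metis dvd_add_left_iff dvd_add_right_iff)
    then show ?thesis using P(2)[OF that(1)] that(2,3) by auto
  qed
  let ?Q = "{B \<in> P. B \<subseteq> ?S}"
  have "partition_on ?S ?Q"
  proof (rule partition_onI)
    show "\<Union> ?Q = ?S"
    proof
      show "?S \<subseteq> \<Union> ?Q"
      proof
        fix C assume C: "C \<in> ?S"
        then obtain B where B: "B \<in> P" "C \<in> B" using partition_onD1[OF P(1)] by blast
        have "B \<subseteq> cycles_of n u" using partition_onD1[OF P(1)] B(1) by blast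
        then have "B \<subseteq> ?S" using mixed[OF B] C by blast
        then show "C \<in> \<Union> ?Q" using B by blast
      qed
    qed blast
    show "disjnt B B'" if "B \<in> ?Q" "B' \<in> ?Q" "B \<noteq> B'" for B B'
      using that partition_onD2[OF P(1)] by (auto simp: disjoint_def disjnt_def)
    show "{} \<notin> ?Q" using partition_onD3[OF P(1)] by blast
  qed
  moreover have "\<exists>C C'. B = {C, C'} \<and> C \<noteq> C' \<and> int m dvd wt a C + wt a C'" if "B \<in> ?Q" for B
    using P(2)[of B] that by blast
  ultimately show ?thesis unfolding cond1_def by blast
qed

lemma (in gmpn) cond2_iff_balanced:
  assumes "u permutes {..<n}"
  shows "cond2 m p n u a \<longleftrightarrow> balanced (mm u a)"
proof -
  let ?f = "\<lambda>C. wt a C mod int m" and ?S = "cycles_of n u"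
  have cond2: "cond2 m p n u a \<longleftrightarrow> (\<forall>T\<subseteq>?S. int p dvd (\<Sum>C\<in>T. wt a C) \<longrightarrow>
    (\<exists>P. partition_on T P \<and> pairing (int m) (int p) (wt a) P))"
    unfolding cond2_def pairing_def ..
  have T: "(\<exists>P. partition_on T P \<and> pairing (int m) (int p) (wt a) P) \<longleftrightarrow> paired (int m) (int p) (image_mset ?f (mset_set T))"
    "int p dvd (\<Sum>C\<in>T. wt a C) \<longleftrightarrow> int p dvd \<Sum>\<^sub># (image_mset ?f (mset_set T))" if "T \<subseteq> ?S" for T
    using paired_iff_pairing[OF ipm, of T "wt a"] sum_mod_image_mset_dvd[OF pm, of T "wt a"]
      finite_subset[OF that finite_cycles_of] by (simp_all only:)
  have W: "W (mm u a) = image_mset ?f (mset_set ?S)"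
    by (simp add: weights_monomial_mat[OF m assms] cycle_weights_def)
  show ?thesis
  proof
    assume c: "cond2 m p n u a"
    show "balanced (mm u a)"
      unfolding balanced_def W
    proof (intro allI impI)
      fix A assume A: "A \<subseteq># image_mset ?f (mset_set ?S)" "int p dvd \<Sum>\<^sub># A"
      obtain T' where "T' \<subseteq> ?S" "A = image_mset ?f (mset_set T')"
        using subset_image_mset_setE[OF finite_cycles_of A(1)] .
      then show "paired (int m) (int p) A" using c A(2) T[of T'] unfolding cond2 by simp
    qed
  next
    assume b: "balanced (mm u a)"
    show "cond2 m p n u a"
      unfolding cond2
    proof (intro allI impI)
      fix T' assume T': "T' \<subseteq> ?S" "int p dvd (\<Sum>C\<in>T'. wt a C)"
      have "image_mset ?f (mset_set T') \<subseteq># W (mm u a)"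
        unfolding W using T'(1) by (intro image_mset_subseteq_mono subset_imp_msubset_mset_set) auto
      then show "\<exists>P. partition_on T' P \<and> pairing (int m) (int p) (wt a) P"
        using b T[OF T'(1)] T'(2) by (simp add: balanced_def)
    qed
  qed
qed

theorem theorem1p1:
  fixes m p n :: nat and u :: "nat \<Rightarrow> nat" and a :: "nat \<Rightarrow> int"
  assumes "m > 0" "p > 0" "n > 0" "p dvd m"
    and "u permutes {..<n}" and "int p dvd wt a {..<n}"
  shows "interval_f m p n (lenR m p n) (monomial_mat m n u a)
           = interval_f m p n (codimfix n) (monomial_mat m n u a)
         \<longleftrightarrow> cond1 m p n u a \<and> cond2 m p n u a"
proof -
  interpret gmpn m p n by unfold_locales (use assms in auto)
  have w: "mm u a \<in> G" using assms G_I by simp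
  have "interval_f m p n (lenR m p n) (mm u a) = interval_f m p n (codimfix n) (mm u a) \<longleftrightarrow> cond2 m p n u a"
    using balanced_imp_intervals_eq[OF w] intervals_eq_imp_balanced[OF w] cond2_iff_balanced[OF assms(5)] by metis
  then show ?thesis using cond2_imp_cond1[OF assms(5,4,6)] by metis
qed

end
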